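(* Let $G$ be a finite group, let $\Bbbk$ be a field of characteristic $0$ over which every ordinary representation of $G$ is defined, let $\alpha : G\to\Bbbk^{\times}$ be a multiplicative character, and let $\tau$ be an involutive automorphism of $G$. Then $\mathcal{L}_{\alpha,\tau}(G) = \mathcal{M}_{\alpha,\tau}(G)$ as Lie subalgebras of $\Bbbk G$.
   Context: The group algebra $\Bbbk G$ is a Lie algebra for $[a,b]=ab-ba$. $\widehat{G}$ denotes the set of irreducible representations of $G$ over $\Bbbk$ up to isomorphism, so that $\Bbbk G = \bigoplus_{V\in\widehat{G}} \mathfrak{gl}(V)$. The setting is that of the antiautomorphism $S$ of $\Bbbk G$ extending $g\mapsto\alpha(g)\tau(g)^{-1}$. $\mathcal{L}_{\alpha,\tau}(G)$ is the Lie subalgebra of $\Bbbk G$ spanned by the elements $g-\alpha(g)\tau(g^{-1})$, $g\in G$. For $V\in\widehat{G}$ given by $\rho: G\to \mathrm{GL}(V)$, let $V^{\sharp}$ be the representation on $V^*$ given by $g\mapsto \alpha(g)\,{}^t\rho(\tau(g)^{-1})$; on characters, $V\mapsto V^\sharp$ is the permutation $\chi\mapsto\alpha\,\overline{\chi}\circ\tau$. For the equivalence relation on $\widehat{G}$ generated by $V\sim V^\sharp$, let $\widehat{G}_{\alpha,\tau}^{even}$ (resp. $\widehat{G}_{\alpha,\tau}^{odd}$) be the set of classes of cardinality $1$ (resp. $2$). - If $V\simeq V^\sharp$, there is a nondegenerate bilinear form $\phi$ on $V$ with $\phi(g x,\tau(g) y)=\alpha(g)\phi(x,y)$ for all $g\in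 G$, $x,y\in V$; set $\mathfrak{osp}_{\alpha,\tau}(V)=\{a\in\mathfrak{gl}(V) : \phi(a x,y)+\phi(x,a y)=0\ \forall x,y\in V\}$. - If $V\not\simeq V^\sharp$, let $\mathfrak{gl}_{\alpha,\tau}(V)$ be the image of $\mathfrak{gl}(V)$ in $\mathfrak{gl}(V)\oplus\mathfrak{gl}(V^\sharp)\subset\Bbbk G$ under $a\mapsto(a,-{}^t a)$. Then $\mathcal{M}_{\alpha,\tau}(G)=\left(\bigoplus_{V\in\widehat{G}_{\alpha,\tau}^{even}}\mathfrak{osp}_{\alpha,\tau}(V)\right)\oplus\left(\bigoplus_{V\in\widehat{G}_{\alpha,\tau}^{odd}}\mathfrak{gl}_{\alpha,\tau}(V)\right)\subset\Bbbk G$.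
   Formalization: The character α is additionally assumed to satisfy α(τ(g)) = α(g) for all g in G; whenever this fails, the trivial representation lies in a class with more than two elements and the claimed equality is false. *)

theory Defs
  imports
    "Jordan_Normal_Form.Matrix"
    "HOL-Algebra.Algebraic_Closure_Type"
    "HOL-Library.Function_Algebras"
begin

section \<open>The group algebra as a Lie algebra\<close>

text \<open>
  Elements of the group algebra of \<open>G\<close> are functions vanishing outside \<open>carrier G\<close>.
  Addition is the pointwise addition of functions; the pointwise product is not used,
  the algebra product being the convolution \<open>ga_mult\<close>.
\<close>

definition group_algebra :: "('g, 'b) monoid_scheme \<Rightarrow> ('g \<Rightarrow> 'k::field) set" where
  "group_algebra G = {x. \<forall>g. g \<notin> carrier G \<longrightarrow> x g = 0}"

definition ga_scale :: "'k::field \<Rightarrow> ('g \<Rightarrow> 'k) \<Rightarrow> ('g \<Rightarrow> 'k)" where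
  "ga_scale c x = (\<lambda>g. c * x g)"

interpretation ga: vector_space "ga_scale :: 'k::field \<Rightarrow> ('g \<Rightarrow> 'k) \<Rightarrow> ('g \<Rightarrow> 'k)"
  by unfold_locales (auto simp: ga_scale_def fun_eq_iff algebra_simps)

definition ga_basis :: "'g \<Rightarrow> ('g \<Rightarrow> 'k::field)" where
  "ga_basis g = (\<lambda>h. if h = g then 1 else 0)"

definition ga_mult ::
    "('g, 'b) monoid_scheme \<Rightarrow> ('g \<Rightarrow> 'k::field) \<Rightarrow> ('g \<Rightarrow> 'k) \<Rightarrow> ('g \<Rightarrow> 'k)" where
  "ga_mult G x y =
    (\<lambda>g. \<Sum>(h, k) | h \<in> carrier G \<and> k \<in> carrier G \<and> h \<otimes>\<^bsub>G\<^esub> k = g. x h * y k)"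

definition lie_subalgebra :: "('g, 'b) monoid_scheme \<Rightarrow> ('g \<Rightarrow> 'k::field) set \<Rightarrow> bool" where
  "lie_subalgebra G L \<longleftrightarrow>
     L \<subseteq> group_algebra G \<and> ga.subspace L \<and>
     (\<forall>x\<in>L. \<forall>y\<in>L. ga_mult G x y - ga_mult G y x \<in> L)"

definition lie_L ::
    "('g, 'b) monoid_scheme \<Rightarrow> ('g \<Rightarrow> 'k::field) \<Rightarrow> ('g \<Rightarrow> 'g) \<Rightarrow> ('g \<Rightarrow> 'k) set" where
  "lie_L G \<alpha> \<tau> =
     ga.span {ga_basis g - ga_scale (\<alpha> g) (ga_basis (\<tau> (inv\<^bsub>G\<^esub> g))) | g. g \<in> carrier G}"


section \<open>Matrix representations\<close>

text \<open>
  A finite-dimensional representation is given by its degree \<open>n\<close> and a homomorphism to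
  \<open>GL\<^sub>n\<close>; the space is \<open>carrier_vec n\<close>, and its dual is again \<open>carrier_vec n\<close> through
  the dual basis, transposition of maps being transposition of matrices.
\<close>

type_synonym ('g, 'k) mrep = "nat \<times> ('g \<Rightarrow> 'k mat)"

definition mult_group :: "'k::field itself \<Rightarrow> 'k monoid" where
  "mult_group ty = \<lparr>carrier = UNIV - {0}, monoid.mult = (*), one = 1\<rparr>"

definition GL :: "'k::field itself \<Rightarrow> nat \<Rightarrow> 'k mat monoid" where
  "GL ty n = units_of (ring_mat ty n ())"

definition is_rep :: "('g, 'b) monoid_scheme \<Rightarrow> ('g, 'k::field) mrep \<Rightarrow> bool" where
  "is_rep G V \<longleftrightarrow> snd V \<in> hom G (GL TYPE('k) (fst V))"

definition invariant_subspace ::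
    "('g, 'b) monoid_scheme \<Rightarrow> ('g, 'k::field) mrep \<Rightarrow> 'k vec set \<Rightarrow> bool" where
  "invariant_subspace G V W \<longleftrightarrow>
     W \<subseteq> carrier_vec (fst V) \<and> 0\<^sub>v (fst V) \<in> W \<and>
     (\<forall>u\<in>W. \<forall>w\<in>W. u + w \<in> W) \<and> (\<forall>c. \<forall>w\<in>W. c \<cdot>\<^sub>v w \<in> W) \<and>
     (\<forall>g\<in>carrier G. \<forall>w\<in>W. snd V g *\<^sub>v w \<in> W)"

definition irreducible_rep :: "('g, 'b) monoid_scheme \<Rightarrow> ('g, 'k::field) mrep \<Rightarrow> bool" where
  "irreducible_rep G V \<longleftrightarrow>
     is_rep G V \<and> fst V > 0 \<and>
     (\<forall>W. invariant_subspace G V W \<longrightarrow> W = {0\<^sub>v (fst V)} \<or> W = carrier_vec (fst V))"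

definition rep_iso ::
    "('g, 'b) monoid_scheme \<Rightarrow> ('g, 'k::field) mrep \<Rightarrow> ('g, 'k) mrep \<Rightarrow> bool" where
  "rep_iso G V W \<longleftrightarrow>
     fst V = fst W \<and>
     (\<exists>P \<in> carrier (GL TYPE('k) (fst V)). \<forall>g\<in>carrier G. P * snd V g = snd W g * P)"

text \<open>
  Every ordinary representation of \<open>G\<close>, that is, every finite-dimensional representation
  over the algebraic closure, is isomorphic to one with coefficients in the base field.
\<close>

definition all_reps_defined_over :: "('g, 'b) monoid_scheme \<Rightarrow> 'k::field itself \<Rightarrow> bool" where
  "all_reps_defined_over G ty \<longleftrightarrow>
     (\<forall>V :: ('g, 'k alg_closure) mrep. is_rep G V \<longrightarrow>
       (\<exists>W :: ('g, 'k) mrep. is_rep G W \<and>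
          rep_iso G V (fst W, \<lambda>g. map_mat to_ac (snd W g))))"

text \<open>The component in \<open>\<gg>\<ll>(V)\<close> of an element of the group algebra.\<close>

definition rep_ext ::
    "('g, 'b) monoid_scheme \<Rightarrow> ('g, 'k::field) mrep \<Rightarrow> ('g \<Rightarrow> 'k) \<Rightarrow> 'k mat" where
  "rep_ext G V x =
     mat (fst V) (fst V) (\<lambda>(i, j). \<Sum>g\<in>carrier G. x g * snd V g $$ (i, j))"


section \<open>Isomorphism classes and the operation sharp\<close>

definition irreps :: "('g, 'b) monoid_scheme \<Rightarrow> ('g, 'k::field) mrep set" where
  "irreps G = {V. irreducible_rep G V}"

definition irr_classes :: "('g, 'b) monoid_scheme \<Rightarrow> ('g, 'k::field) mrep set set" where
  "irr_classes G = irreps G // {(V, W). V \<in> irreps G \<and> W \<in> irreps G \<and> rep_iso G V W}"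

definition sharp ::
    "('g, 'b) monoid_scheme \<Rightarrow> ('g \<Rightarrow> 'k::field) \<Rightarrow> ('g \<Rightarrow> 'g) \<Rightarrow> ('g, 'k) mrep \<Rightarrow> ('g, 'k) mrep" where
  "sharp G \<alpha> \<tau> V =
     (fst V, \<lambda>g. \<alpha> g \<cdot>\<^sub>m transpose_mat (snd V (inv\<^bsub>G\<^esub> (\<tau> g))))"

definition sharp_rel ::
    "('g, 'b) monoid_scheme \<Rightarrow> ('g \<Rightarrow> 'k::field) \<Rightarrow> ('g \<Rightarrow> 'g) \<Rightarrow> ('g, 'k) mrep set rel" where
  "sharp_rel G \<alpha> \<tau> =
     {(c, d). c \<in> irr_classes G \<and> d \<in> irr_classes G \<and> (\<exists>V\<in>c. sharp G \<alpha> \<tau> V \<in> d)}"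

definition sharp_classes ::
    "('g, 'b) monoid_scheme \<Rightarrow> ('g \<Rightarrow> 'k::field) \<Rightarrow> ('g \<Rightarrow> 'g) \<Rightarrow> ('g, 'k) mrep set set set" where
  "sharp_classes G \<alpha> \<tau> = irr_classes G // (sharp_rel G \<alpha> \<tau> \<union> (sharp_rel G \<alpha> \<tau>)\<inverse>)\<^sup>*"

definition even_classes ::
    "('g, 'b) monoid_scheme \<Rightarrow> ('g \<Rightarrow> 'k::field) \<Rightarrow> ('g \<Rightarrow> 'g) \<Rightarrow> ('g, 'k) mrep set set set" where
  "even_classes G \<alpha> \<tau> = {C \<in> sharp_classes G \<alpha> \<tau>. card C = 1}"

definition odd_classes ::
    "('g, 'b) monoid_scheme \<Rightarrow> ('g \<Rightarrow> 'k::field) \<Rightarrow> ('g \<Rightarrow> 'g) \<Rightarrow> ('g, 'k) mrep set set set" where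
  "odd_classes G \<alpha> \<tau> = {C \<in> sharp_classes G \<alpha> \<tau>. card C = 2}"

text \<open>
  An element \<open>C\<close> of \<open>sharp_classes\<close> is a set of isomorphism classes, so its members
  have to be unpacked twice to reach a representation.
\<close>

definition class_rep :: "('g, 'k) mrep set set \<Rightarrow> ('g, 'k) mrep" where
  "class_rep C = (SOME V. V \<in> \<Union>C)"


section \<open>The Lie algebra attached to the decomposition\<close>

definition nondegenerate_bilinear_form :: "nat \<Rightarrow> ('k::field vec \<Rightarrow> 'k vec \<Rightarrow> 'k) \<Rightarrow> bool" where
  "nondegenerate_bilinear_form n \<phi> \<longleftrightarrow>
     (\<forall>x\<in>carrier_vec n. \<forall>y\<in>carrier_vec n. \<forall>z\<in>carrier_vec n.
        \<phi> (x + y) z = \<phi> x z + \<phi> y z \<and> \<phi> z (x + y) = \<phi> z x + \<phi> z y) \<and>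
     (\<forall>c. \<forall>x\<in>carrier_vec n. \<forall>y\<in>carrier_vec n.
        \<phi> (c \<cdot>\<^sub>v x) y = c * \<phi> x y \<and> \<phi> x (c \<cdot>\<^sub>v y) = c * \<phi> x y) \<and>
     (\<forall>x\<in>carrier_vec n. (\<forall>y\<in>carrier_vec n. \<phi> x y = 0) \<longrightarrow> x = 0\<^sub>v n) \<and>
     (\<forall>y\<in>carrier_vec n. (\<forall>x\<in>carrier_vec n. \<phi> x y = 0) \<longrightarrow> y = 0\<^sub>v n)"

definition is_sharp_form ::
    "('g, 'b) monoid_scheme \<Rightarrow> ('g \<Rightarrow> 'k::field) \<Rightarrow> ('g \<Rightarrow> 'g) \<Rightarrow> ('g, 'k) mrep
      \<Rightarrow> ('k vec \<Rightarrow> 'k vec \<Rightarrow> 'k) \<Rightarrow> bool" where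
  "is_sharp_form G \<alpha> \<tau> V \<phi> \<longleftrightarrow>
     nondegenerate_bilinear_form (fst V) \<phi> \<and>
     (\<forall>g\<in>carrier G. \<forall>x\<in>carrier_vec (fst V). \<forall>y\<in>carrier_vec (fst V).
        \<phi> (snd V g *\<^sub>v x) (snd V (\<tau> g) *\<^sub>v y) = \<alpha> g * \<phi> x y)"

text \<open>
  The form is only determined up to a nonzero scalar, which does not affect \<open>osp\<close>.
\<close>

definition sharp_form ::
    "('g, 'b) monoid_scheme \<Rightarrow> ('g \<Rightarrow> 'k::field) \<Rightarrow> ('g \<Rightarrow> 'g) \<Rightarrow> ('g, 'k) mrep
      \<Rightarrow> ('k vec \<Rightarrow> 'k vec \<Rightarrow> 'k)" where
  "sharp_form G \<alpha> \<tau> V = (SOME \<phi>. is_sharp_form G \<alpha> \<tau> V \<phi>)"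

definition osp ::
    "('g, 'b) monoid_scheme \<Rightarrow> ('g \<Rightarrow> 'k::field) \<Rightarrow> ('g \<Rightarrow> 'g) \<Rightarrow> ('g, 'k) mrep \<Rightarrow> 'k mat set" where
  "osp G \<alpha> \<tau> V =
     {a \<in> carrier_mat (fst V) (fst V).
        \<forall>x\<in>carrier_vec (fst V). \<forall>y\<in>carrier_vec (fst V).
          sharp_form G \<alpha> \<tau> V (a *\<^sub>v x) y + sharp_form G \<alpha> \<tau> V x (a *\<^sub>v y) = 0}"

text \<open>
  Under the identification \<open>x \<mapsto> (rep_ext G V x)\<^sub>V\<close> of the group algebra with
  \<open>\<Oplus>\<^sub>V \<gg>\<ll>(V)\<close>, \<open>supported_on G S\<close> is the sum of the \<open>\<gg>\<ll>(V)\<close> with \<open>V \<in> S\<close>: the elements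
  whose components at all irreducible representations not isomorphic to a member of \<open>S\<close> vanish.
\<close>

definition supported_on ::
    "('g, 'b) monoid_scheme \<Rightarrow> ('g, 'k::field) mrep set \<Rightarrow> ('g \<Rightarrow> 'k) set" where
  "supported_on G S =
     {x \<in> group_algebra G. \<forall>W\<in>irreps G.
        (\<forall>V\<in>S. \<not> rep_iso G V W) \<longrightarrow> rep_ext G W x = 0\<^sub>m (fst W) (fst W)}"

definition osp_part ::
    "('g, 'b) monoid_scheme \<Rightarrow> ('g \<Rightarrow> 'k::field) \<Rightarrow> ('g \<Rightarrow> 'g) \<Rightarrow> ('g, 'k) mrep \<Rightarrow> ('g \<Rightarrow> 'k) set" where
  "osp_part G \<alpha> \<tau> V = {x \<in> supported_on G {V}. rep_ext G V x \<in> osp G \<alpha> \<tau> V}"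

definition gl_part ::
    "('g, 'b) monoid_scheme \<Rightarrow> ('g \<Rightarrow> 'k::field) \<Rightarrow> ('g \<Rightarrow> 'g) \<Rightarrow> ('g, 'k) mrep \<Rightarrow> ('g \<Rightarrow> 'k) set" where
  "gl_part G \<alpha> \<tau> V =
     {x \<in> supported_on G {V, sharp G \<alpha> \<tau> V}.
        (rep_ext G V x, rep_ext G (sharp G \<alpha> \<tau> V) x)
          \<in> (\<lambda>a. (a, - transpose_mat a)) ` carrier_mat (fst V) (fst V)}"

text \<open>
  The sum of subspaces is written as the span of their union. It is direct because
  distinct summands lie in sums of disjoint families of blocks \<open>\<gg>\<ll>(V)\<close>.
\<close>

definition lie_M ::
    "('g, 'b) monoid_scheme \<Rightarrow> ('g \<Rightarrow> 'k::field) \<Rightarrow> ('g \<Rightarrow> 'g) \<Rightarrow> ('g \<Rightarrow> 'k) set" where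
  "lie_M G \<alpha> \<tau> = ga.span
     ((\<Union>C\<in>even_classes G \<alpha> \<tau>. osp_part G \<alpha> \<tau> (class_rep C)) \<union>
      (\<Union>C\<in>odd_classes G \<alpha> \<tau>. gl_part G \<alpha> \<tau> (class_rep C)))"

end

theory Submission
  imports Defs
begin

text \<open>
  Extending \<open>g \<mapsto> \<alpha> g \<tau> (g\<inverse>)\<close> linearly gives an involutive antiautomorphism \<open>S\<close> of the group algebra,
  and \<open>lie_L\<close> is its \<open>-1\<close>-eigenspace, a Lie subalgebra. The component of \<open>S x\<close> at \<open>V\<close> is the transpose
  of the component of \<open>x\<close> at \<open>V\<^sup>\<sharp>\<close>. Hence an element supported on the blocks of \<open>V\<close> and \<open>V\<^sup>\<sharp>\<close> lies in the
  eigenspace iff its components \<open>a\<close>, \<open>b\<close> at \<open>V\<close>, \<open>V\<^sup>\<sharp>\<close> satisfy \<open>b = - a\<^sup>T\<close>; if \<open>V \<simeq> V\<^sup>\<sharp>\<close> through the matrix of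
  the form, this is the condition defining \<open>osp\<close>. Since the group algebra is the sum of its blocks,
  writing an element of the eigenspace as \<open>(x - S x) / 2\<close> block by block puts it into \<open>lie_M\<close>.

  The block decomposition is used in the following form, valid over any field of characteristic \<open>0\<close>:
  elements killed by all irreducible representations vanish (Maschke), and the matrix coefficients
  \<open>g \<mapsto> \<rho> (g\<inverse>)\<^sub>l\<^sub>j\<close> of \<open>V\<close> lie in the block of \<open>V\<close> (Schur). A linear form on the group algebra vanishing on
  all blocks is then killed by all irreducible representations when read as a group algebra element
  through \<open>g \<mapsto> g\<inverse>\<close>, so it is \<open>0\<close>.
\<close>

section \<open>Linear algebra\<close>

lemma sum_fun_apply: "(\<Sum>i\<in>A. f i) x = (\<Sum>i\<in>A. f i x)"
  for f :: "'i \<Rightarrow> 'a \<Rightarrow> 'b::comm_monoid_add"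
  by (induction A rule: infinite_finite_induct) auto

lemma ga_scale_apply [simp]: "ga_scale c x g = c * x g"
  by (simp add: ga_scale_def)

text \<open>The identity is injective on \<open>N\<close>, so it has a linear left inverse there
  whose range lies in \<open>N\<close>. Such a map is a projection onto \<open>N\<close>.\<close>

lemma ga_projection_exists:
  fixes N :: "('a \<Rightarrow> 'k::field) set"
  assumes "ga.subspace N"
  obtains p :: "('a \<Rightarrow> 'k) \<Rightarrow> 'a \<Rightarrow> 'k"
  where "\<And>x. p x \<in> N" "\<And>x. x \<in> N \<Longrightarrow> p x = x"
    "\<And>x y. p (x + y) = p x + p y" "\<And>c x. p (ga_scale c x) = ga_scale c (p x)"
proof -
  interpret pair: vector_space_pair "ga_scale :: 'k \<Rightarrow> _ \<Rightarrow> 'a \<Rightarrow> 'k" "ga_scale :: 'k \<Rightarrow> _ \<Rightarrow> 'a \<Rightarrow> 'k" ..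
  obtain p where p: "range p \<subseteq> N" "Vector_Spaces.linear ga_scale ga_scale p" "\<forall>v\<in>N. p (id v) = v"
    using pair.linear_exists_left_inverse_on[OF ga.linear_id assms] by (metis inj_on_id)
  then show thesis
    using that[of p] by (simp add: linear_iff_module_hom module_hom_iff image_subset_iff)
qed

text \<open>For a projection \<open>p\<close> onto \<open>N\<close>, the map \<open>y - p y\<close>
  kills \<open>N\<close> but not \<open>x\<close>. Its value at \<open>x\<close> is a nonzero
  function, and evaluation at a point \<open>h\<close> where that function does not vanish gives the
  form.\<close>

lemma linear_form_separating:
  fixes N :: "('a \<Rightarrow> 'k::field) set"
  assumes "ga.subspace N" "x \<notin> N"
  obtains f :: "('a \<Rightarrow> 'k) \<Rightarrow> 'k"
  where "\<And>y z. f (y + z) = f y + f z" "\<And>c y. f (ga_scale c y) = c * f y"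
    "\<And>y. y \<in> N \<Longrightarrow> f y = 0" "f x \<noteq> 0"
proof -
  obtain p where p: "\<And>y. p y \<in> N" "\<And>y. y \<in> N \<Longrightarrow> p y = y"
    "\<And>y z. p (y + z) = p y + p z" "\<And>c y. p (ga_scale c y) = ga_scale c (p y)"
    using ga_projection_exists[OF assms(1)] by blast
  have "p x \<noteq> x"
    using p(1) assms(2) by metis
  then obtain h where h: "p x h \<noteq> x h"
    by (auto simp: fun_eq_iff)
  show thesis
    by (rule that[of "\<lambda>y. y h - p y h"]) (use h p in \<open>auto simp: algebra_simps\<close>)
qed

lemma additive_sum:
  fixes f :: "'a::ab_group_add \<Rightarrow> 'b::ab_group_add"
  assumes "\<And>y z. f (y + z) = f y + f z"
  shows "f (\<Sum>i\<in>A. g i) = (\<Sum>i\<in>A. f (g i))"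
proof -
  have "f 0 = 0"
    using assms[of 0 0] by simp
  then show ?thesis
    by (induction A rule: infinite_finite_induct) (auto simp: assms)
qed

text \<open>Transports coordinate vectors into a function space, where the theory of spans, bases
  and dimension of \<open>ga\<close> is available. It serves both for embedding
  \<open>carrier_vec n\<close> and for parametrising left ideals by a basis.\<close>

definition lincomb :: "nat \<Rightarrow> (nat \<Rightarrow> 'a \<Rightarrow> 'k::field) \<Rightarrow> 'k vec \<Rightarrow> 'a \<Rightarrow> 'k" where
  "lincomb n f v = (\<Sum>i<n. ga_scale (v $ i) (f i))"

lemma lincomb_apply: "lincomb n f v h = (\<Sum>i<n. v $ i * f i h)"
  by (simp add: lincomb_def sum_fun_apply)

lemma lincomb_add:
  "v \<in> carrier_vec n \<Longrightarrow> w \<in> carrier_vec n \<Longrightarrow> lincomb n f (v + w) = lincomb n f v + lincomb n f w"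
  by (rule ext) (simp add: lincomb_apply sum.distrib distrib_right)

lemma lincomb_smult: "v \<in> carrier_vec n \<Longrightarrow> lincomb n f (c \<cdot>\<^sub>v v) = ga_scale c (lincomb n f v)"
  by (rule ext) (simp add: lincomb_apply sum_distrib_left mult.assoc)

lemma lincomb_zero [simp]: "lincomb n f (0\<^sub>v n) = 0"
  by (rule ext) (simp add: lincomb_apply)

section \<open>Matrices, scalar products and bilinear forms\<close>

lemma mat_eqI_mult_vec:
  fixes A B :: "'k::field mat"
  assumes A: "A \<in> carrier_mat n m" and B: "B \<in> carrier_mat n m"
    and eq: "\<And>v. v \<in> carrier_vec m \<Longrightarrow> A *\<^sub>v v = B *\<^sub>v v"
  shows "A = B"
proof (rule eq_matI)
  fix i j assume ij: "i < dim_row B" "j < dim_col B"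
  have "(A *\<^sub>v unit_vec m j) $ i = (B *\<^sub>v unit_vec m j) $ i"
    by (simp add: eq)
  then show "A $$ (i, j) = B $$ (i, j)"
    using ij A B by simp
qed (use A B in auto)

text \<open>Preimages of the unit vectors are taken as the columns of \<open>Q\<close>.\<close>

lemma right_inverse_of_surj_mat:
  fixes P :: "'k::field mat"
  assumes P: "P \<in> carrier_mat n m" and surj: "\<And>w. w \<in> carrier_vec n \<Longrightarrow> \<exists>v\<in>carrier_vec m. P *\<^sub>v v = w"
  obtains Q where "Q \<in> carrier_mat m n" "P * Q = 1\<^sub>m n"
proof -
  have "\<forall>i. \<exists>v\<in>carrier_vec m. P *\<^sub>v v = unit_vec n i"
    using surj by simp
  then obtain q where q: "\<And>i. q i \<in> carrier_vec m" "\<And>i. P *\<^sub>v q i = unit_vec n i"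
    by metis
  define Q where "Q = mat m n (\<lambda>(i, j). q j $ i)"
  have Q: "Q \<in> carrier_mat m n"
    by (simp add: Q_def)
  have col: "col Q j = q j" if "j < n" for j
    using that q(1)[of j] by (intro eq_vecI) (auto simp: Q_def)
  have "P * Q = 1\<^sub>m n"
  proof (rule eq_matI)
    fix i j assume "i < dim_row (1\<^sub>m n :: 'k mat)" "j < dim_col (1\<^sub>m n :: 'k mat)"
    then have ij: "i < n" "j < n" by auto
    have "(P * Q) $$ (i, j) = (P *\<^sub>v q j) $ i"
      using ij P Q col by simp
    then show "(P * Q) $$ (i, j) = 1\<^sub>m n $$ (i, j)"
      using ij by (simp add: q)
  qed (use P Q in auto)
  with Q show thesis
    by (rule that)
qed

lemma mult_mat_index_sum:
  assumes "A \<in> carrier_mat n m" "B \<in> carrier_mat m p" "i < n" "j < p"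
  shows "(A * B) $$ (i, j) = (\<Sum>k<m. A $$ (i, k) * B $$ (k, j))"
  using assms by (simp add: scalar_prod_def lessThan_atLeast0)

text \<open>\<open>P * Q\<close> and \<open>Q * P\<close> have the same trace. For the two identity
  matrices the traces are \<open>n\<close> and \<open>m\<close>, which characteristic 0 keeps
  apart.\<close>

lemma dim_eq_of_mutually_inverse_mats:
  fixes P :: "'k::field_char_0 mat"
  assumes "P \<in> carrier_mat n m" "Q \<in> carrier_mat m n" "P * Q = 1\<^sub>m n" "Q * P = 1\<^sub>m m"
  shows "n = m"
proof -
  have "of_nat n = (\<Sum>i<n. (P * Q) $$ (i, i))"
    by (simp add: assms(3))
  also have "\<dots> = (\<Sum>i<n. \<Sum>j<m. P $$ (i, j) * Q $$ (j, i))"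
    by (simp add: mult_mat_index_sum[OF assms(1,2)])
  also have "\<dots> = (\<Sum>j<m. \<Sum>i<n. Q $$ (j, i) * P $$ (i, j))"
    by (subst sum.swap) (simp add: mult.commute)
  also have "\<dots> = (\<Sum>j<m. (Q * P) $$ (j, j))"
    by (simp add: mult_mat_index_sum[OF assms(2,1)])
  also have "\<dots> = of_nat m"
    by (simp add: assms(4))
  finally show ?thesis
    by simp
qed

lemma zero_mult_mat_vec: "v \<in> carrier_vec m \<Longrightarrow> 0\<^sub>m n m *\<^sub>v v = 0\<^sub>v n"
  by (rule eq_vecI) (auto simp: scalar_prod_def)

lemma mult_mat_zero_vec: "A \<in> carrier_mat n m \<Longrightarrow> A *\<^sub>v 0\<^sub>v m = 0\<^sub>v n"
  by (rule eq_vecI) (auto simp: scalar_prod_def)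

lemma eq_vec_of_diff_zero:
  fixes v w :: "'k::ring vec"
  assumes "v - w = 0\<^sub>v n" "v \<in> carrier_vec n" "w \<in> carrier_vec n"
  shows "v = w"
proof (rule eq_vecI)
  fix i assume "i < dim_vec w"
  then have "v $ i - w $ i = (v - w) $ i" "i < n"
    using assms(3) by (simp_all only: index_minus_vec carrier_vecD)
  then show "v $ i = w $ i"
    by (simp add: assms(1))
qed (use assms in auto)

lemma smult_mat_mult_vec:
  fixes A :: "'k::field mat"
  assumes "A \<in> carrier_mat n m" "v \<in> carrier_vec m"
  shows "(c \<cdot>\<^sub>m A) *\<^sub>v v = c \<cdot>\<^sub>v (A *\<^sub>v v)"
proof (rule eq_vecI)
  fix i assume "i < dim_vec (c \<cdot>\<^sub>v (A *\<^sub>v v))"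
  then show "((c \<cdot>\<^sub>m A) *\<^sub>v v) $ i = (c \<cdot>\<^sub>v (A *\<^sub>v v)) $ i"
    using assms by (simp add: scalar_prod_def sum_distrib_left mult.assoc)
qed simp

lemma vec_eq_0_if_scalar_prod_0:
  fixes x :: "'k::field vec"
  assumes x: "x \<in> carrier_vec n" and "\<And>z. z \<in> carrier_vec n \<Longrightarrow> x \<bullet> z = 0"
  shows "x = 0\<^sub>v n"
proof (rule eq_vecI)
  fix i assume "i < dim_vec (0\<^sub>v n :: 'k vec)"
  then show "x $ i = 0\<^sub>v n $ i"
    using assms(2)[of "unit_vec n i"] by simp
qed (use x in simp)

lemma mat_eqI_scalar_prod:
  fixes A B :: "'k::field mat"
  assumes A: "A \<in> carrier_mat n n" and B: "B \<in> carrier_mat n n"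
    and eq: "\<And>x y. x \<in> carrier_vec n \<Longrightarrow> y \<in> carrier_vec n \<Longrightarrow> x \<bullet> (A *\<^sub>v y) = x \<bullet> (B *\<^sub>v y)"
  shows "A = B"
proof (rule eq_matI)
  fix i j assume "i < dim_row B" "j < dim_col B"
  then have ij: "i < n" "j < n"
    using B by auto
  have "unit_vec n i \<bullet> (M *\<^sub>v unit_vec n j) = M $$ (i, j)" if "M \<in> carrier_mat n n" for M :: "'k mat"
  proof -
    have "M *\<^sub>v unit_vec n j \<in> carrier_vec n"
      using that by simp
    then show ?thesis
      using ij that by simp
  qed
  then show "A $$ (i, j) = B $$ (i, j)"
    using eq[of "unit_vec n i" "unit_vec n j"] A B by simp
qed (use A B in auto)

lemma linear_form_vec_expand:
  fixes f :: "'k::field vec \<Rightarrow> 'k"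
  assumes add: "\<And>x y. x \<in> carrier_vec n \<Longrightarrow> y \<in> carrier_vec n \<Longrightarrow> f (x + y) = f x + f y"
    and smult: "\<And>c x. x \<in> carrier_vec n \<Longrightarrow> f (c \<cdot>\<^sub>v x) = c * f x"
    and x: "x \<in> carrier_vec n"
  shows "f x = (\<Sum>i<n. x $ i * f (unit_vec n i))"
proof -
  \<comment> \<open>The truncations of \<open>x\<close> to its first \<open>m\<close> coordinates
    allow an induction that adds one multiple of a unit vector at a time.\<close>
  have partial: "f (vec n (\<lambda>i. if i < m then x $ i else 0)) = (\<Sum>i<m. x $ i * f (unit_vec n i))"
    if "m \<le> n" for m
    using that
  proof (induction m)
    case 0
    \<comment> \<open>Writing the zero vector as 0 times a vector yields \<open>f 0 = 0\<close> from
      homogeneity.\<close>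
    have "vec n (\<lambda>i. if i < 0 then x $ i else 0) = 0 \<cdot>\<^sub>v 0\<^sub>v n"
      by (rule eq_vecI) auto
    then show ?case
      using smult[of "0\<^sub>v n" 0] by simp
  next
    case (Suc m)
    have "vec n (\<lambda>i. if i < Suc m then x $ i else 0)
        = vec n (\<lambda>i. if i < m then x $ i else 0) + x $ m \<cdot>\<^sub>v unit_vec n m"
      using Suc.prems by (intro eq_vecI) (auto simp: less_Suc_eq)
    then show ?case
      using Suc by (simp add: add smult)
  qed
  have "vec n (\<lambda>i. if i < n then x $ i else 0) = x"
    using x by (intro eq_vecI) auto
  with partial[of n] show ?thesis
    by simp
qed

lemma scalar_prod_mult_mat_vec:
  fixes A :: "'k::field mat"
  assumes "A \<in> carrier_mat n n" "x \<in> carrier_vec n" "z \<in> carrier_vec n"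
  shows "(A *\<^sub>v x) \<bullet> z = x \<bullet> (transpose_mat A *\<^sub>v z)"
  using transpose_vec_mult_scalar[of "transpose_mat A" n n z x] assms by simp

lemma bilinear_form_mat:
  fixes \<phi> :: "'k::field vec \<Rightarrow> 'k vec \<Rightarrow> 'k"
  assumes "nondegenerate_bilinear_form n \<phi>"
  obtains B where "B \<in> carrier_mat n n"
    "\<And>x y. x \<in> carrier_vec n \<Longrightarrow> y \<in> carrier_vec n \<Longrightarrow> \<phi> x y = x \<bullet> (B *\<^sub>v y)"
proof
  define B where "B = mat n n (\<lambda>(i, j). \<phi> (unit_vec n i) (unit_vec n j))"
  show "B \<in> carrier_mat n n"
    by (simp add: B_def)
  have add: "\<phi> (x + y) z = \<phi> x z + \<phi> y z" "\<phi> z (x + y) = \<phi> z x + \<phi> z y"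
    if "x \<in> carrier_vec n" "y \<in> carrier_vec n" "z \<in> carrier_vec n" for x y z
    using assms that unfolding nondegenerate_bilinear_form_def by blast+
  have smult: "\<phi> (c \<cdot>\<^sub>v x) y = c * \<phi> x y" "\<phi> x (c \<cdot>\<^sub>v y) = c * \<phi> x y"
    if "x \<in> carrier_vec n" "y \<in> carrier_vec n" for c x y
    using assms that unfolding nondegenerate_bilinear_form_def by blast+
  fix x y :: "'k vec" assume x: "x \<in> carrier_vec n" and y: "y \<in> carrier_vec n"
  have "\<phi> x y = (\<Sum>i<n. x $ i * \<phi> (unit_vec n i) y)"
    using linear_form_vec_expand[of n "\<lambda>x. \<phi> x y" x, OF add(1) smult(1) x] y by simp
  also have "\<dots> = (\<Sum>i<n. x $ i * (\<Sum>j<n. y $ j * \<phi> (unit_vec n i) (unit_vec n j)))"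
    using linear_form_vec_expand[of n "\<phi> (unit_vec n _)" y, OF add(2) smult(2) y] by simp
  also have "\<dots> = x \<bullet> (B *\<^sub>v y)"
    using y by (simp add: B_def scalar_prod_def lessThan_atLeast0 mult.commute)
  finally show "\<phi> x y = x \<bullet> (B *\<^sub>v y)" .
qed

text \<open>After embedding \<open>carrier_vec n\<close> into the functions on the natural numbers,
  a linear form separates \<open>w\<close> from the image of \<open>U\<close>. The coordinates of
  \<open>v\<close> are its values on the basis functions, so that the form becomes the scalar
  product with \<open>v\<close>.\<close>

lemma annihilating_vec_exists:
  fixes U :: "'k::field vec set"
  assumes U: "U \<subseteq> carrier_vec n" "0\<^sub>v n \<in> U" "\<And>u w. u \<in> U \<Longrightarrow> w \<in> U \<Longrightarrow> u + w \<in> U"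
      "\<And>c u. u \<in> U \<Longrightarrow> c \<cdot>\<^sub>v u \<in> U"
    and w: "w \<in> carrier_vec n" "w \<notin> U"
  obtains v where "v \<in> carrier_vec n" "v \<noteq> 0\<^sub>v n" "\<And>u. u \<in> U \<Longrightarrow> v \<bullet> u = 0"
proof -
  let ?emb = "lincomb n ga_basis :: 'k vec \<Rightarrow> nat \<Rightarrow> 'k"
  have emb: "?emb v i = (if i < n then v $ i else 0)" for v i
    by (simp add: lincomb_apply ga_basis_def if_distrib cong: if_cong)
  have inj: "v = v'" if "?emb v = ?emb v'" "v \<in> carrier_vec n" "v' \<in> carrier_vec n" for v v'
  proof (rule eq_vecI)
    fix i assume "i < dim_vec v'"
    then show "v $ i = v' $ i"
      using fun_cong[OF that(1), of i] that(3) by (simp add: emb)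
  qed (use that in simp)
  have sub: "ga.subspace (?emb ` U)"
  proof (rule ga.subspaceI)
    show "0 \<in> ?emb ` U"
      using U(2) lincomb_zero by (metis image_eqI)
    show "x + y \<in> ?emb ` U" if xy: "x \<in> ?emb ` U" "y \<in> ?emb ` U" for x y
    proof -
      obtain u w where uw: "u \<in> U" "w \<in> U" "x = ?emb u" "y = ?emb w"
        using xy by blast
      have "x + y = ?emb (u + w)"
        unfolding uw(3,4) using uw(1,2) U(1) by (intro lincomb_add[symmetric]) auto
      with U(3)[OF uw(1,2)] show ?thesis
        by (rule image_eqI[rotated])
    qed
    show "ga_scale c x \<in> ?emb ` U" if x: "x \<in> ?emb ` U" for c x
    proof -
      obtain u where u: "u \<in> U" "x = ?emb u"
        using x by blast
      have "ga_scale c x = ?emb (c \<cdot>\<^sub>v u)"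
        unfolding u(2) using u(1) U(1) by (intro lincomb_smult[symmetric]) auto
      with U(4)[OF u(1)] show ?thesis
        by (rule image_eqI[rotated])
    qed
  qed
  have not_mem: "?emb w \<notin> ?emb ` U"
  proof
    assume "?emb w \<in> ?emb ` U"
    then obtain u where u: "u \<in> U" "?emb w = ?emb u"
      by blast
    have "w = u"
      using u U(1) w(1) by (intro inj) auto
    with u(1) w(2) show False
      by blast
  qed
  obtain f :: "(nat \<Rightarrow> 'k) \<Rightarrow> 'k" where f: "\<And>y z. f (y + z) = f y + f z"
    "\<And>c y. f (ga_scale c y) = c * f y" "\<And>y. y \<in> ?emb ` U \<Longrightarrow> f y = 0" "f (?emb w) \<noteq> 0"
    by (rule linear_form_separating[OF sub not_mem], rule that)
  define v where "v = vec n (\<lambda>i. f (ga_basis i))"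
  have v: "v \<in> carrier_vec n"
    by (simp add: v_def)
  have f_emb: "f (?emb u) = v \<bullet> u" if "u \<in> carrier_vec n" for u
  proof -
    have "f (?emb u) = (\<Sum>i<n. f (ga_scale (u $ i) (ga_basis i)))"
      unfolding lincomb_def by (rule additive_sum[where f = f]) (rule f(1))
    then show ?thesis
      using that by (simp add: f(2) v_def scalar_prod_def lessThan_atLeast0 mult.commute)
  qed
  have "v \<noteq> 0\<^sub>v n"
    using f(4) f_emb[OF w(1)] w(1) by auto
  moreover have "v \<bullet> u = 0" if "u \<in> U" for u
    using f(3)[of "?emb u"] f_emb[of u] that U(1) by auto
  ultimately show thesis
    using that v by blast
qed

section \<open>Matrix representations\<close>

lemma GL_iff:
  "P \<in> carrier (GL TYPE('k::field) n) \<longleftrightarrow>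
    P \<in> carrier_mat n n \<and> (\<exists>Q \<in> carrier_mat n n. P * Q = 1\<^sub>m n \<and> Q * P = 1\<^sub>m n)"
  by (auto simp: GL_def units_of_def Units_def ring_mat_def)

lemma GL_mult [simp]: "x \<otimes>\<^bsub>GL ty n\<^esub> y = x * y"
  by (simp add: GL_def units_of_def ring_mat_def)

lemma rep_iso_iff:
  "rep_iso G V W \<longleftrightarrow> fst V = fst W \<and>
    (\<exists>P \<in> carrier_mat (fst V) (fst V). \<exists>Q \<in> carrier_mat (fst V) (fst V).
      P * Q = 1\<^sub>m (fst V) \<and> Q * P = 1\<^sub>m (fst V) \<and> (\<forall>g\<in>carrier G. P * snd V g = snd W g * P))"
  unfolding rep_iso_def GL_iff Bex_def by auto

lemma rep_isoI:
  assumes "fst V = fst W" "P \<in> carrier_mat (fst W) (fst W)" "Q \<in> carrier_mat (fst W) (fst W)"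
    "P * Q = 1\<^sub>m (fst W)" "Q * P = 1\<^sub>m (fst W)" "\<And>g. g \<in> carrier G \<Longrightarrow> P * snd V g = snd W g * P"
  shows "rep_iso G V W"
  unfolding rep_iso_iff assms(1)
  by (intro conjI refl bexI[of _ P] bexI[of _ Q] ballI assms)

lemma rep_isoE:
  assumes "rep_iso G V W"
  obtains P Q where "fst V = fst W" "P \<in> carrier_mat (fst W) (fst W)" "Q \<in> carrier_mat (fst W) (fst W)"
    "P * Q = 1\<^sub>m (fst W)" "Q * P = 1\<^sub>m (fst W)" "\<And>g. g \<in> carrier G \<Longrightarrow> P * snd V g = snd W g * P"
  using assms unfolding rep_iso_iff by force

lemma intertwiner_inverse:
  fixes P :: "'k::field mat"
  assumes "P \<in> carrier_mat n n" "Q \<in> carrier_mat n n" "P * Q = 1\<^sub>m n" "Q * P = 1\<^sub>m n"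
    "A \<in> carrier_mat n n" "B \<in> carrier_mat n n" "P * A = B * P"
  shows "Q * B = A * Q"
proof -
  have "Q * B = Q * B * (P * Q)"
    using assms by simp
  also have "\<dots> = Q * (B * P) * Q"
    using assms(1,2,5,6) by (simp add: assoc_mult_mat[of _ n n _ n _ n])
  also have "\<dots> = Q * (P * A) * Q"
    using assms by simp
  also have "\<dots> = (Q * P) * A * Q"
    using assms(1,2,5,6) by (simp add: assoc_mult_mat[of _ n n _ n _ n])
  finally show ?thesis
    using assms by simp
qed

context group
begin

lemma is_repD:
  assumes "is_rep G (V :: ('a, 'k::field) mrep)"
  shows "g \<in> carrier G \<Longrightarrow> snd V g \<in> carrier_mat (fst V) (fst V)"
    and "g \<in> carrier G \<Longrightarrow> h \<in> carrier G \<Longrightarrow> snd V (g \<otimes> h) = snd V g * snd V h"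
    and "snd V \<one> = 1\<^sub>m (fst V)"
proof -
  let ?\<rho> = "snd V" and ?n = "fst V"
  have hom: "?\<rho> \<in> hom G (GL TYPE('k) ?n)"
    using assms by (simp add: is_rep_def)
  have GL: "?\<rho> g \<in> carrier (GL TYPE('k) ?n)" if "g \<in> carrier G" for g
    using hom that by (auto simp: hom_def)
  show carrier: "?\<rho> g \<in> carrier_mat ?n ?n" if "g \<in> carrier G" for g
    using GL[OF that] by (simp add: GL_iff)
  show mult: "?\<rho> (g \<otimes> h) = ?\<rho> g * ?\<rho> h" if "g \<in> carrier G" "h \<in> carrier G" for g h
    using hom that by (auto simp: hom_def)
  obtain Q where Q: "Q \<in> carrier_mat ?n ?n" "?\<rho> \<one> * Q = 1\<^sub>m ?n" "Q * ?\<rho> \<one> = 1\<^sub>m ?n"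
    using GL[of \<one>] by (auto simp: GL_iff)
  \<comment> \<open>The image of the neutral element is idempotent and invertible, hence the
    identity matrix.\<close>
  have "?\<rho> \<one> = Q * ?\<rho> \<one> * ?\<rho> \<one>"
    using carrier[of \<one>] Q by simp
  also have "\<dots> = Q * (?\<rho> \<one> * ?\<rho> \<one>)"
    using carrier[of \<one>] Q(1) by (intro assoc_mult_mat) auto
  also have "\<dots> = 1\<^sub>m ?n"
    using mult[of \<one> \<one>] Q by simp
  finally show "?\<rho> \<one> = 1\<^sub>m ?n" .
qed

lemma is_repI:
  fixes V :: "('a, 'k::field) mrep"
  assumes carrier: "\<And>g. g \<in> carrier G \<Longrightarrow> snd V g \<in> carrier_mat (fst V) (fst V)"
    and mult: "\<And>g h. g \<in> carrier G \<Longrightarrow> h \<in> carrier G \<Longrightarrow> snd V (g \<otimes> h) = snd V g * snd V h"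
    and one: "snd V \<one> = 1\<^sub>m (fst V)"
  shows "is_rep G V"
proof -
  \<comment> \<open>The inverse matrix is the image of \<open>inv g\<close>.\<close>
  have "snd V g \<in> carrier (GL TYPE('k) (fst V))" if "g \<in> carrier G" for g
    unfolding GL_iff
    using carrier[OF that] carrier[of "inv g"] mult[of g "inv g"] mult[of "inv g" g] one that
    by auto
  then show ?thesis
    by (auto simp: is_rep_def hom_def mult)
qed

lemma rep_iso_refl: "is_rep G V \<Longrightarrow> rep_iso G V V"
  by (rule rep_isoI[of _ _ "1\<^sub>m (fst V)" "1\<^sub>m (fst V)"])
    (auto simp: left_mult_one_mat[OF is_repD(1)] right_mult_one_mat[OF is_repD(1)])

lemma rep_iso_sym:
  assumes "rep_iso G V W" "is_rep G V" "is_rep G W"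
  shows "rep_iso G W V"
proof -
  obtain P Q where *: "fst V = fst W" "P \<in> carrier_mat (fst W) (fst W)" "Q \<in> carrier_mat (fst W) (fst W)"
    "P * Q = 1\<^sub>m (fst W)" "Q * P = 1\<^sub>m (fst W)" "\<And>g. g \<in> carrier G \<Longrightarrow> P * snd V g = snd W g * P"
    by (rule rep_isoE[OF assms(1)], rule that)
  have "Q * snd W g = snd V g * Q" if "g \<in> carrier G" for g
    using *(1) is_repD(1)[OF assms(2) that] is_repD(1)[OF assms(3) that] *(6)[OF that]
    by (intro intertwiner_inverse[OF *(2-5)]) simp_all
  with *(1-5) show ?thesis
    by (intro rep_isoI[of W V Q P]) simp_all
qed

lemma rep_iso_trans:
  assumes "rep_iso G U V" "rep_iso G V W" "is_rep G U" "is_rep G V" "is_rep G W"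
  shows "rep_iso G U W"
proof -
  obtain P Q where 1: "fst U = fst V" "P \<in> carrier_mat (fst V) (fst V)" "Q \<in> carrier_mat (fst V) (fst V)"
    "P * Q = 1\<^sub>m (fst V)" "Q * P = 1\<^sub>m (fst V)" "\<And>g. g \<in> carrier G \<Longrightarrow> P * snd U g = snd V g * P"
    by (rule rep_isoE[OF assms(1)], rule that)
  obtain P' Q' where 2: "fst V = fst W" "P' \<in> carrier_mat (fst W) (fst W)" "Q' \<in> carrier_mat (fst W) (fst W)"
    "P' * Q' = 1\<^sub>m (fst W)" "Q' * P' = 1\<^sub>m (fst W)" "\<And>g. g \<in> carrier G \<Longrightarrow> P' * snd V g = snd W g * P'"
    by (rule rep_isoE[OF assms(2)], rule that)
  let ?n = "fst W"
  note mat = 1(2,3)[unfolded 2(1)] 2(2,3)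
  have "P' * P * (Q * Q') = P' * (P * Q) * Q'" "Q * Q' * (P' * P) = Q * (Q' * P') * P"
    using mat by (simp_all add: assoc_mult_mat[of _ ?n ?n _ ?n _ ?n])
  then have inv: "P' * P * (Q * Q') = 1\<^sub>m ?n" "Q * Q' * (P' * P) = 1\<^sub>m ?n"
    using 1(4,5) 2(1,4,5) mat by simp_all
  have comm: "P' * P * snd U g = snd W g * (P' * P)" if g: "g \<in> carrier G" for g
  proof -
    have m: "snd U g \<in> carrier_mat ?n ?n" "snd V g \<in> carrier_mat ?n ?n" "snd W g \<in> carrier_mat ?n ?n"
      using is_repD(1)[OF assms(3) g] is_repD(1)[OF assms(4) g] is_repD(1)[OF assms(5) g] 1(1) 2(1) by simp_all
    have "P' * P * snd U g = P' * (P * snd U g)"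
      using mat m by (intro assoc_mult_mat) auto
    also have "\<dots> = P' * (snd V g * P)"
      using 1(6) g by simp
    also have "\<dots> = P' * snd V g * P"
      using mat m by (intro assoc_mult_mat[symmetric]) auto
    also have "\<dots> = snd W g * P' * P"
      using 2(6) g by simp
    also have "\<dots> = snd W g * (P' * P)"
      using mat m by (intro assoc_mult_mat) auto
    finally show ?thesis .
  qed
  show ?thesis
    using 1(1) 2(1) by (intro rep_isoI[OF _ _ _ inv comm] mult_carrier_mat[OF mat(3) mat(1)] mult_carrier_mat[OF mat(2) mat(4)]) simp_all
qed

end

section \<open>Linear extension of representations to the group algebra, and Schur's lemma\<close>

lemma rep_ext_carrier [simp]: "rep_ext G V x \<in> carrier_mat (fst V) (fst V)"
  by (simp add: rep_ext_def)

lemma rep_ext_dim [simp]: "dim_row (rep_ext G V x) = fst V" "dim_col (rep_ext G V x) = fst V"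
  by (simp_all add: rep_ext_def)

lemma rep_ext_index:
  "i < fst V \<Longrightarrow> j < fst V \<Longrightarrow> rep_ext G V x $$ (i, j) = (\<Sum>g\<in>carrier G. x g * snd V g $$ (i, j))"
  by (simp add: rep_ext_def)

lemma rep_ext_add: "rep_ext G V (x + y) = rep_ext G V x + rep_ext G V y"
  by (rule eq_matI) (auto simp: rep_ext_index sum.distrib algebra_simps)

lemma rep_ext_diff: "rep_ext G V (x - y) = rep_ext G V x - rep_ext G V y"
  by (rule eq_matI) (auto simp: rep_ext_index sum_subtractf left_diff_distrib)

lemma rep_ext_uminus: "rep_ext G V (- x) = - rep_ext G V x"
  by (rule eq_matI) (auto simp: rep_ext_index sum_negf)

lemma rep_ext_cong:
  assumes "fst V = fst W" "\<And>g. g \<in> carrier G \<Longrightarrow> snd V g = snd W g"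
  shows "rep_ext G V x = rep_ext G W x"
  using assms by (simp add: rep_ext_def)

lemma irreducible_repD: "V \<in> irreps G \<Longrightarrow> is_rep G V"
  by (simp add: irreps_def irreducible_rep_def)

lemma invariant_subspace_irreducible:
  assumes "V \<in> irreps G" "invariant_subspace G V W" "w \<in> W" "w \<noteq> 0\<^sub>v (fst V)"
  shows "W = carrier_vec (fst V)"
  using assms by (auto simp: irreps_def irreducible_rep_def)

locale fin_group = group G for G (structure) +
  assumes finite_carrier [simp]: "finite (carrier G)"
begin

lemma sum_translate:
  assumes "h \<in> carrier G"
  shows "(\<Sum>g\<in>carrier G. f (h \<otimes> g)) = (\<Sum>g\<in>carrier G. f g)"
  by (rule sum.reindex_bij_witness[of _ "\<lambda>g. inv h \<otimes> g" "\<lambda>g. h \<otimes> g"])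
    (use assms in \<open>auto simp: m_assoc[symmetric]\<close>)

lemma mult_rep_ext_index:
  assumes "is_rep G V" "P \<in> carrier_mat n (fst V)" "i < n" "j < fst V"
  shows "(P * rep_ext G V x) $$ (i, j) = (\<Sum>g\<in>carrier G. x g * (P * snd V g) $$ (i, j))"
proof -
  have "(P * rep_ext G V x) $$ (i, j)
      = (\<Sum>k<fst V. \<Sum>g\<in>carrier G. x g * (P $$ (i, k) * snd V g $$ (k, j)))"
    using assms(4) by (simp add: mult_mat_index_sum[OF assms(2) rep_ext_carrier assms(3,4)] rep_ext_index sum_distrib_left mult_ac)
  also have "\<dots> = (\<Sum>g\<in>carrier G. x g * (\<Sum>k<fst V. P $$ (i, k) * snd V g $$ (k, j)))"
    by (subst sum.swap) (simp add: sum_distrib_left)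
  also have "\<dots> = (\<Sum>g\<in>carrier G. x g * (P * snd V g) $$ (i, j))"
    by (simp add: mult_mat_index_sum[OF assms(2) is_repD(1)[OF assms(1)] assms(3,4)])
  finally show ?thesis .
qed

lemma rep_ext_mult_index:
  assumes "is_rep G V" "P \<in> carrier_mat (fst V) n" "i < fst V" "j < n"
  shows "(rep_ext G V x * P) $$ (i, j) = (\<Sum>g\<in>carrier G. x g * (snd V g * P) $$ (i, j))"
proof -
  have "(rep_ext G V x * P) $$ (i, j)
      = (\<Sum>k<fst V. \<Sum>g\<in>carrier G. x g * (snd V g $$ (i, k) * P $$ (k, j)))"
    using assms(3) by (simp add: mult_mat_index_sum[OF rep_ext_carrier assms(2-4)] rep_ext_index sum_distrib_left mult_ac)
  also have "\<dots> = (\<Sum>g\<in>carrier G. x g * (\<Sum>k<fst V. snd V g $$ (i, k) * P $$ (k, j)))"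
    by (subst sum.swap) (simp add: sum_distrib_left)
  also have "\<dots> = (\<Sum>g\<in>carrier G. x g * (snd V g * P) $$ (i, j))"
    by (simp add: mult_mat_index_sum[OF is_repD(1)[OF assms(1)] assms(2-4)])
  finally show ?thesis .
qed

lemma rep_ext_intertwine:
  assumes "is_rep G V" "is_rep G W" "P \<in> carrier_mat (fst W) (fst V)"
    and "\<And>g. g \<in> carrier G \<Longrightarrow> P * snd V g = snd W g * P"
  shows "P * rep_ext G V x = rep_ext G W x * P"
proof (rule eq_matI)
  fix i j assume "i < dim_row (rep_ext G W x * P)" "j < dim_col (rep_ext G W x * P)"
  then have ij: "i < fst W" "j < fst V"
    using assms(3) by auto
  show "(P * rep_ext G V x) $$ (i, j) = (rep_ext G W x * P) $$ (i, j)"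
    unfolding mult_rep_ext_index[OF assms(1,3) ij] rep_ext_mult_index[OF assms(2,3) ij]
    by (intro sum.cong refl) (simp add: assms(4))
qed (use assms(3) in auto)

lemma rep_ext_eq_0_iso:
  assumes "rep_iso G V W" "is_rep G V" "is_rep G W" "rep_ext G V x = 0\<^sub>m (fst V) (fst V)"
  shows "rep_ext G W x = 0\<^sub>m (fst W) (fst W)"
proof -
  obtain P Q where PQ: "fst V = fst W" "P \<in> carrier_mat (fst W) (fst W)" "Q \<in> carrier_mat (fst W) (fst W)"
    "P * Q = 1\<^sub>m (fst W)" "Q * P = 1\<^sub>m (fst W)" "\<And>g. g \<in> carrier G \<Longrightarrow> P * snd V g = snd W g * P"
    by (rule rep_isoE[OF assms(1)], rule that)
  have "P * rep_ext G V x = rep_ext G W x * P"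
    using assms(2,3) PQ(1,2,6) by (intro rep_ext_intertwine) simp_all
  then have "rep_ext G W x * P * Q = 0\<^sub>m (fst W) (fst W)"
    using PQ(1-3) assms(4) by (metis left_mult_zero_mat right_mult_zero_mat)
  then show ?thesis
    using assoc_mult_mat[OF rep_ext_carrier[of G W x] PQ(2,3)] PQ(4) by simp
qed

text \<open>Schur's lemma. The kernel \<open>K\<close> is an invariant subspace of \<open>V\<close>
  missing some vector, hence zero; the image \<open>R\<close> is a nonzero invariant subspace of
  \<open>W\<close>, hence everything. Surjectivity gives a right inverse, injectivity makes it
  two-sided, and the trace argument then gives equal degrees.\<close>

lemma irreducible_intertwiner_invertible:
  fixes V W :: "('a, 'k::field_char_0) mrep"
  assumes V: "V \<in> irreps G" and W: "W \<in> irreps G" and P: "P \<in> carrier_mat (fst W) (fst V)"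
    and comm: "\<And>g. g \<in> carrier G \<Longrightarrow> P * snd V g = snd W g * P"
    and "P \<noteq> 0\<^sub>m (fst W) (fst V)"
  obtains Q where "fst V = fst W" "Q \<in> carrier_mat (fst V) (fst W)"
    "P * Q = 1\<^sub>m (fst W)" "Q * P = 1\<^sub>m (fst V)"
proof -
  let ?m = "fst V" and ?n = "fst W"
  note VG = is_repD(1)[OF irreducible_repD[OF V]] and WG = is_repD(1)[OF irreducible_repD[OF W]]
  have comm_vec: "P *\<^sub>v (snd V g *\<^sub>v v) = snd W g *\<^sub>v (P *\<^sub>v v)" if "g \<in> carrier G" "v \<in> carrier_vec ?m" for g v
    using comm[OF that(1)] assoc_mult_mat_vec[OF P VG[OF that(1)] that(2)]
      assoc_mult_mat_vec[OF WG[OF that(1)] P that(2)] by simp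
  have V_vec: "snd V g *\<^sub>v v \<in> carrier_vec ?m" if "g \<in> carrier G" "v \<in> carrier_vec ?m" for g v
    using VG that by (meson mult_mat_vec_carrier)
  have W_zero: "snd W g *\<^sub>v 0\<^sub>v ?n = 0\<^sub>v ?n" if "g \<in> carrier G" for g
    using WG that by (meson mult_mat_zero_vec)
  obtain u where u: "u \<in> carrier_vec ?m" "P *\<^sub>v u \<noteq> 0\<^sub>v ?n"
  proof -
    have "\<exists>u\<in>carrier_vec ?m. P *\<^sub>v u \<noteq> 0\<^sub>m ?n ?m *\<^sub>v u"
      using mat_eqI_mult_vec[OF P, of "0\<^sub>m ?n ?m"] assms(5) by auto
    then show thesis
      using that by (auto simp: zero_mult_mat_vec)
  qed
  define K where "K = {v \<in> carrier_vec ?m. P *\<^sub>v v = 0\<^sub>v ?n}"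
  have "invariant_subspace G V K"
    unfolding invariant_subspace_def K_def
    by (auto simp: mult_mat_zero_vec[OF P] mult_add_distrib_mat_vec[OF P] mult_mat_vec[OF P] comm_vec V_vec W_zero)
  then have K: "v = 0\<^sub>v ?m" if "v \<in> carrier_vec ?m" "P *\<^sub>v v = 0\<^sub>v ?n" for v
    using invariant_subspace_irreducible[OF V, of K v] that u by (auto simp: K_def)
  define R where "R = (\<lambda>v. P *\<^sub>v v) ` carrier_vec ?m"
  have "invariant_subspace G W R"
    unfolding invariant_subspace_def R_def
  proof (intro conjI ballI allI)
    show "0\<^sub>v ?n \<in> (\<lambda>v. P *\<^sub>v v) ` carrier_vec ?m"
      by (rule image_eqI[of _ _ "0\<^sub>v ?m"]) (use mult_mat_zero_vec[OF P] in auto)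
  qed (use P V_vec in \<open>auto simp: mult_add_distrib_mat_vec[OF P, symmetric] mult_mat_vec[OF P, symmetric]
      comm_vec[symmetric]\<close>)
  then have R: "R = carrier_vec ?n"
    using u by (intro invariant_subspace_irreducible[OF W, of _ "P *\<^sub>v u"]) (auto simp: R_def)
  obtain Q where Q: "Q \<in> carrier_mat ?m ?n" "P * Q = 1\<^sub>m ?n"
    using right_inverse_of_surj_mat[OF P] R unfolding R_def by (metis imageE)
  \<comment> \<open>Since \<open>P * Q\<close> is the identity, \<open>P\<close> sends
    \<open>Q * P *\<^sub>v v - v\<close> to zero, and \<open>K\<close> says that \<open>P\<close> is
    injective.\<close>
  have QP: "Q * P = 1\<^sub>m ?m"
  proof (rule mat_eqI_mult_vec)
    fix v :: "'k vec" assume v: "v \<in> carrier_vec ?m"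
    have "P *\<^sub>v (Q * P *\<^sub>v v - v) = P *\<^sub>v (Q * P *\<^sub>v v) - P *\<^sub>v v"
      using P Q v by (intro mult_minus_distrib_mat_vec) auto
    also have "P *\<^sub>v (Q * P *\<^sub>v v) = (P * Q) *\<^sub>v (P *\<^sub>v v)"
      using P Q(1) v by (simp add: assoc_mult_mat_vec[of _ ?m ?n] assoc_mult_mat_vec[of _ ?n ?m _ ?n])
    finally have "P *\<^sub>v (Q * P *\<^sub>v v - v) = 0\<^sub>v ?n"
      using P Q v by simp
    then have "Q * P *\<^sub>v v - v = 0\<^sub>v ?m"
      using P Q v by (intro K) auto
    then have "Q * P *\<^sub>v v = v"
      by (rule eq_vec_of_diff_zero) (use P Q v in auto)
    then show "Q * P *\<^sub>v v = 1\<^sub>m ?m *\<^sub>v v"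
      using v by simp
  qed (use P Q in auto)
  have "?n = ?m"
    using dim_eq_of_mutually_inverse_mats[OF P Q(1) Q(2) QP] .
  with Q QP show thesis
    by (intro that) simp_all
qed

lemma irreducible_intertwiner_iso:
  fixes V W :: "('a, 'k::field_char_0) mrep"
  assumes "V \<in> irreps G" "W \<in> irreps G" "P \<in> carrier_mat (fst W) (fst V)"
    and "\<And>g. g \<in> carrier G \<Longrightarrow> P * snd V g = snd W g * P"
    and "P \<noteq> 0\<^sub>m (fst W) (fst V)"
  shows "rep_iso G V W"
proof -
  obtain Q where "fst V = fst W" "Q \<in> carrier_mat (fst V) (fst W)"
    "P * Q = 1\<^sub>m (fst W)" "Q * P = 1\<^sub>m (fst V)"
    by (rule irreducible_intertwiner_invertible[OF assms(1-3) _ assms(5)]) (erule assms(4), rule that)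
  with assms(3,4) show ?thesis
    by (intro rep_isoI[of V W P Q]) simp_all
qed

text \<open>Read as an element of the group algebra, this is a scalar multiple of a matrix unit in
  the block of \<open>V\<close> when \<open>V\<close> is absolutely irreducible. The inverse makes
  averages of these coefficients against another representation into intertwiners.\<close>

definition inv_coeff :: "('a, 'k::field) mrep \<Rightarrow> nat \<Rightarrow> nat \<Rightarrow> 'a \<Rightarrow> 'k" where
  "inv_coeff V l j = (\<lambda>g. if g \<in> carrier G then snd V (inv g) $$ (l, j) else 0)"

text \<open>This is the vanishing half of Schur orthogonality. Each entry of the component at
  \<open>W\<close> is an entry of an averaged matrix that intertwines \<open>V\<close> with
  \<open>W\<close>, and such a matrix is zero unless the two are isomorphic.\<close>

lemma inv_coeff_supported_on:
  fixes V :: "('a, 'k::field_char_0) mrep"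
  assumes V: "V \<in> irreps G" and lj: "l < fst V" "j < fst V"
  shows "inv_coeff V l j \<in> supported_on G {V}"
proof -
  have "rep_ext G W (inv_coeff V l j) = 0\<^sub>m (fst W) (fst W)"
    if W: "W \<in> irreps G" and not_iso: "\<not> rep_iso G V W" for W
  proof (rule eq_matI)
    let ?m = "fst V" and ?n = "fst W"
    note VG = is_repD[OF irreducible_repD[OF V]] and WG = is_repD[OF irreducible_repD[OF W]]
    fix i k assume "i < dim_row (0\<^sub>m ?n ?n :: 'k mat)" "k < dim_col (0\<^sub>m ?n ?n :: 'k mat)"
    then have ik: "i < ?n" "k < ?n"
      by auto
    \<comment> \<open>the sum of the \<open>\<rho>\<^sub>W(g) E\<^sub>k\<^sub>l \<rho>\<^sub>V(g\<inverse>)\<close>, which intertwines \<open>V\<close> and \<open>W\<close>\<close>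
    define T where "T = mat ?n ?m (\<lambda>(i, j). \<Sum>g\<in>carrier G. snd W g $$ (i, k) * snd V (inv g) $$ (l, j))"
    have T: "T \<in> carrier_mat ?n ?m"
      by (simp add: T_def)
    have T_index: "T $$ (i, j) = (\<Sum>g\<in>carrier G. snd W g $$ (i, k) * snd V (inv g) $$ (l, j))"
      if "i < ?n" "j < ?m" for i j
      using that by (simp add: T_def)
    have "T * snd V h = snd W h * T" if h: "h \<in> carrier G" for h
    proof (rule eq_matI)
      fix i j assume "i < dim_row (snd W h * T)" "j < dim_col (snd W h * T)"
      then have ij: "i < ?n" "j < ?m"
        using WG(1)[OF h] T by auto
      have "(T * snd V h) $$ (i, j)
          = (\<Sum>s<?m. \<Sum>g\<in>carrier G. snd W g $$ (i, k) * (snd V (inv g) $$ (l, s) * snd V h $$ (s, j)))"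
        using ij(1) by (simp add: mult_mat_index_sum[OF T VG(1)[OF h] ij] T_index sum_distrib_left mult_ac)
      also have "\<dots> = (\<Sum>g\<in>carrier G. snd W g $$ (i, k) * (\<Sum>s<?m. snd V (inv g) $$ (l, s) * snd V h $$ (s, j)))"
        by (subst sum.swap) (simp add: sum_distrib_left)
      also have "\<dots> = (\<Sum>g\<in>carrier G. snd W g $$ (i, k) * snd V (inv g \<otimes> h) $$ (l, j))"
        by (simp add: VG(2) h mult_mat_index_sum[OF VG(1) VG(1) lj(1) ij(2)])
      \<comment> \<open>Substituting \<open>h \<otimes> g\<close> for \<open>g\<close> cancels the
        factor \<open>h\<close> inside \<open>snd V\<close> and makes it appear inside
        \<open>snd W\<close>.\<close>
      also have "\<dots> = (\<Sum>g\<in>carrier G. snd W (h \<otimes> g) $$ (i, k) * snd V (inv g) $$ (l, j))"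
        by (subst sum_translate[OF h, symmetric])
          (intro sum.cong refl, use h in \<open>simp add: inv_mult_group m_assoc\<close>)
      also have "\<dots> = (\<Sum>g\<in>carrier G. (\<Sum>s<?n. snd W h $$ (i, s) * snd W g $$ (s, k)) * snd V (inv g) $$ (l, j))"
        by (simp add: WG(2) h mult_mat_index_sum[OF WG(1) WG(1) ij(1) ik(2)])
      also have "\<dots> = (\<Sum>s<?n. \<Sum>g\<in>carrier G. snd W h $$ (i, s) * (snd W g $$ (s, k) * snd V (inv g) $$ (l, j)))"
        by (subst sum.swap) (simp add: sum_distrib_right mult.assoc)
      also have "\<dots> = (snd W h * T) $$ (i, j)"
        using ij(2) by (simp add: mult_mat_index_sum[OF WG(1)[OF h] T ij] T_index sum_distrib_left)
      finally show "(T * snd V h) $$ (i, j) = (snd W h * T) $$ (i, j)" .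
    qed (use T VG(1)[OF h] WG(1)[OF h] in auto)
    then have "T = 0\<^sub>m ?n ?m"
      using irreducible_intertwiner_iso[OF V W T] not_iso by blast
    then have "T $$ (i, j) = 0"
      using ik lj by simp
    then show "rep_ext G W (inv_coeff V l j) $$ (i, k) = 0\<^sub>m ?n ?n $$ (i, k)"
      using ik lj by (simp add: rep_ext_index T_index inv_coeff_def mult.commute)
  qed auto
  then show ?thesis
    by (auto simp: supported_on_def group_algebra_def inv_coeff_def)
qed

section \<open>The block decomposition\<close>

lemma subspace_group_algebra: "ga.subspace (group_algebra G)"
  by (auto simp: ga.subspace_def group_algebra_def)

lemma group_algebra_expand:
  assumes "x \<in> group_algebra G"
  shows "x = (\<Sum>g\<in>carrier G. ga_scale (x g) (ga_basis g))"
proof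
  fix h
  have "(\<Sum>g\<in>carrier G. x g * (if h = g then 1 else 0)) = (if h \<in> carrier G then x h else 0)"
    by (simp add: if_distrib cong: if_cong)
  also have "\<dots> = x h"
    using assms by (auto simp: group_algebra_def)
  finally show "x h = (\<Sum>g\<in>carrier G. ga_scale (x g) (ga_basis g)) h"
    by (simp add: sum_fun_apply ga_basis_def)
qed

text \<open>For \<open>g\<close> in the group this is left multiplication by
  \<open>ga_basis g\<close>, written through coefficients so that no convolution sum has to be
  handled. The value 0 off the carrier keeps the result in \<open>group_algebra G\<close>.\<close>

definition lact :: "'a \<Rightarrow> ('a \<Rightarrow> 'k::field) \<Rightarrow> 'a \<Rightarrow> 'k" where
  "lact g x = (\<lambda>h. if h \<in> carrier G then x (inv g \<otimes> h) else 0)"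

lemma lact_add: "lact g (x + y) = lact g x + lact g y"
  by (auto simp: lact_def fun_eq_iff)

lemma lact_scale: "lact g (ga_scale c x) = ga_scale c (lact g x)"
  by (auto simp: lact_def fun_eq_iff)

lemma lact_sum: "lact g (\<Sum>i\<in>A. f i) = (\<Sum>i\<in>A. lact g (f i))"
  by (rule additive_sum[where f = "lact g"]) (rule lact_add)

lemma lact_mult: "g \<in> carrier G \<Longrightarrow> h \<in> carrier G \<Longrightarrow> lact (g \<otimes> h) x = lact g (lact h x)"
  by (auto simp: lact_def fun_eq_iff inv_mult_group m_assoc)

lemma lact_one: "x \<in> group_algebra G \<Longrightarrow> lact \<one> x = x"
  by (auto simp: lact_def fun_eq_iff group_algebra_def)

lemma lact_group_algebra: "lact g x \<in> group_algebra G"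
  by (auto simp: lact_def group_algebra_def)

lemma lact_basis_one: "g \<in> carrier G \<Longrightarrow> lact g (ga_basis \<one>) = ga_basis g"
  by (auto simp: lact_def ga_basis_def fun_eq_iff inv_solve_left')

text \<open>Group elements span the algebra, so stability of a subspace under their translations
  amounts to stability under left multiplication by all of it.\<close>

definition left_ideal :: "('a \<Rightarrow> 'k::field) set \<Rightarrow> bool" where
  "left_ideal I \<longleftrightarrow> ga.subspace I \<and> I \<subseteq> group_algebra G \<and> (\<forall>g\<in>carrier G. \<forall>x\<in>I. lact g x \<in> I)"

lemma finite_basis_exists:
  fixes I :: "('a \<Rightarrow> 'k::field) set"
  assumes "ga.subspace I" "I \<subseteq> group_algebra G"
  obtains B where "finite B" "ga.independent B" "ga.span B = I"
proof -
  obtain B where B: "B \<subseteq> I" "ga.independent B" "I \<subseteq> ga.span B"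
    by (rule ga.maximal_independent_subset)
  have "group_algebra G \<subseteq> ga.span (ga_basis ` carrier G :: ('a \<Rightarrow> 'k) set)"
  proof
    fix x :: "'a \<Rightarrow> 'k" assume "x \<in> group_algebra G"
    then show "x \<in> ga.span (ga_basis ` carrier G)"
      by (subst group_algebra_expand) (assumption, intro ga.span_sum ga.span_scale ga.span_base imageI)
  qed
  with B(1) assms(2) have "finite B"
    using ga.independent_span_bound[OF _ B(2), of "ga_basis ` carrier G"] by auto
  moreover have "ga.span B = I"
    using B assms(1) by (metis ga.span_minimal subset_antisym)
  ultimately show thesis
    using that B(2) by blast
qed

text \<open>A nonzero left ideal inside \<open>J\<close> of least dimension is minimal. Dimensions
  are represented by cardinalities of finite bases, so that \<open>LEAST\<close> can be
  used.\<close>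

lemma minimal_left_ideal_exists:
  fixes J :: "('a \<Rightarrow> 'k::field) set"
  assumes "left_ideal J" "J \<noteq> {0}"
  obtains I where "left_ideal I" "I \<subseteq> J" "I \<noteq> {0}"
    "\<And>I'. left_ideal I' \<Longrightarrow> I' \<subseteq> I \<Longrightarrow> I' \<noteq> {0} \<Longrightarrow> I' = I"
proof -
  define has_dim where "has_dim n \<longleftrightarrow> (\<exists>B. finite B \<and> card B = n \<and> ga.independent B \<and>
    left_ideal (ga.span B) \<and> ga.span B \<subseteq> J \<and> ga.span B \<noteq> {0})" for n
  have basis: "\<exists>B. finite B \<and> ga.independent B \<and> ga.span B = I" if "left_ideal I" for I :: "('a \<Rightarrow> 'k) set"
    using that finite_basis_exists[of I] unfolding left_ideal_def by metis
  have "\<exists>n. has_dim n"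
    using basis[OF assms(1)] assms unfolding has_dim_def by blast
  then have "has_dim (LEAST n. has_dim n)"
    by (rule LeastI_ex)
  then obtain B where B: "finite B" "card B = (LEAST n. has_dim n)" "ga.independent B"
    "left_ideal (ga.span B)" "ga.span B \<subseteq> J" "ga.span B \<noteq> {0}"
    unfolding has_dim_def by blast
  have "I' = ga.span B" if I': "left_ideal I'" "I' \<subseteq> ga.span B" "I' \<noteq> {0}" for I'
  proof (rule ccontr)
    assume "I' \<noteq> ga.span B"
    then obtain y where y: "y \<in> ga.span B" "y \<notin> I'"
      using I'(2) by blast
    obtain B' where B': "finite B'" "ga.independent B'" "ga.span B' = I'"
      using basis[OF I'(1)] by blast
    have "has_dim (card B')"
      unfolding has_dim_def using B' I' B(5) by blast
    then have "card B \<le> card B'"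
      unfolding B(2) by (rule Least_le)
    \<comment> \<open>A vector outside the smaller ideal \<open>I'\<close> enlarges its basis to an
      independent set inside \<open>ga.span B\<close>. This makes the dimension of \<open>I'\<close>
      strictly smaller, against the choice of \<open>B\<close>.\<close>
    moreover have "ga.independent (insert y B')" "insert y B' \<subseteq> ga.span B"
      using B' y I'(2) ga.span_superset[of B'] by (auto simp: ga.independent_insert)
    then have "card (insert y B') \<le> card B"
      using ga.independent_span_bound[OF B(1)] by blast
    moreover have "y \<notin> B'"
      using B'(3) y(2) ga.span_base by blast
    ultimately show False
      using B'(1) by simp
  qed
  with B(4-6) show thesis
    by (intro that) auto
qed

text \<open>Left translation on \<open>I\<close> is written in matrices with respect to a basis
  \<open>f\<close>, and \<open>lincomb\<close> is the resulting isomorphism from coordinate vectors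
  onto \<open>I\<close>. The homomorphism laws for the matrices are pulled back from
  \<open>lact\<close> through this injection.\<close>

lemma left_ideal_rep:
  fixes I :: "('a \<Rightarrow> 'k::field) set"
  assumes "left_ideal I"
  obtains V f where "is_rep G V" "inj_on (lincomb (fst V) f) (carrier_vec (fst V))"
    "lincomb (fst V) f ` carrier_vec (fst V) = I"
    "\<And>g v. g \<in> carrier G \<Longrightarrow> v \<in> carrier_vec (fst V) \<Longrightarrow>
      lincomb (fst V) f (snd V g *\<^sub>v v) = lact g (lincomb (fst V) f v)"
proof -
  note I = assms[unfolded left_ideal_def]
  obtain B where B: "finite B" "ga.independent B" "ga.span B = I"
    using finite_basis_exists I by metis
  define n where "n = card B"
  obtain f where f: "bij_betw f {..<n} B"
    using ex_bij_betw_nat_finite[OF B(1)] by (auto simp: n_def lessThan_atLeast0)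
  have f_B: "f i \<in> B" if "i < n" for i
    using f that by (auto simp: bij_betw_def)
  then have f_I: "f i \<in> I" if "i < n" for i
    using B(3) ga.span_base that by blast
  \<comment> \<open>Coordinates with respect to \<open>B\<close>, ordered by \<open>f\<close>; on
    \<open>I\<close> they invert \<open>lincomb n f\<close>.\<close>
  define coord where "coord y = vec n (\<lambda>i. ga.representation B y (f i))" for y
  have coord [simp]: "coord y \<in> carrier_vec n" for y
    by (simp add: coord_def)
  let ?lin = "lincomb n f"
  have lin_I: "?lin v \<in> I" for v
    unfolding lincomb_def using I f_I by (intro ga.subspace_sum ga.subspace_scale) auto
  have lin_coord: "?lin (coord y) = y" if "y \<in> I" for y
  proof -
    have "?lin (coord y) = (\<Sum>i<n. ga_scale (ga.representation B y (f i)) (f i))"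
      by (simp add: lincomb_def coord_def)
    also have "\<dots> = (\<Sum>b\<in>B. ga_scale (ga.representation B y b) b)"
      by (rule sum.reindex_bij_betw[OF f])
    also have "\<dots> = y"
      using B that by (intro ga.sum_representation_eq) auto
    finally show ?thesis .
  qed
  have coord_sum: "coord (\<Sum>j<n. ga_scale (c j) (y j)) $ i = (\<Sum>j<n. c j * coord (y j) $ i)"
    if "i < n" "\<And>j. j < n \<Longrightarrow> y j \<in> I" for c y i
  proof -
    have "ga.representation B (\<Sum>j<n. ga_scale (c j) (y j))
        = (\<lambda>b. \<Sum>j<n. ga.representation B (ga_scale (c j) (y j)) b)"
      using that(2) B(3) by (intro ga.representation_sum[OF B(2)] ga.span_scale) auto
    then show ?thesis
      using that B by (simp add: coord_def ga.representation_scale)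
  qed
  have coord_lin: "coord (?lin v) = v" if "v \<in> carrier_vec n" for v
  proof (rule eq_vecI)
    fix i assume "i < dim_vec v"
    then have i: "i < n"
      using that by simp
    have "coord (?lin v) $ i = (\<Sum>j<n. v $ j * coord (f j) $ i)"
      unfolding lincomb_def using i f_I by (rule coord_sum)
    also have "\<dots> = (\<Sum>j<n. v $ j * (if i = j then 1 else 0))"
    proof (intro sum.cong refl)
      fix j assume "j \<in> {..<n}"
      then have "f i = f j \<longleftrightarrow> i = j"
        using f i by (auto simp: bij_betw_def inj_on_def)
      then show "v $ j * coord (f j) $ i = v $ j * (if i = j then 1 else 0)"
        using i f_B \<open>j \<in> {..<n}\<close> by (simp add: coord_def ga.representation_basis[OF B(2)])
    qed
    also have "\<dots> = v $ i"
      using i by (simp add: if_distrib cong: if_cong)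
    finally show "coord (?lin v) $ i = v $ i" .
  qed (use that in \<open>simp add: coord_def\<close>)
  have inj: "inj_on ?lin (carrier_vec n)"
    by (rule inj_on_inverseI[of _ coord]) (rule coord_lin)
  define R where "R g = mat n n (\<lambda>(i, j). coord (lact g (f j)) $ i)" for g
  have R: "R g \<in> carrier_mat n n" for g
    by (simp add: R_def)
  have equivariant: "?lin (R g *\<^sub>v v) = lact g (?lin v)" if g: "g \<in> carrier G" and v: "v \<in> carrier_vec n" for g v
  proof -
    have lact_f: "lact g (f j) \<in> I" if "j < n" for j
      using I f_I g that by blast
    have "R g *\<^sub>v v = coord (lact g (?lin v))"
    proof (rule eq_vecI)
      fix i assume "i < dim_vec (coord (lact g (?lin v)))"
      then have i: "i < n"
        by (simp add: coord_def)
      have "coord (lact g (?lin v)) $ i = (\<Sum>j<n. v $ j * coord (lact g (f j)) $ i)"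
        using coord_sum[OF i lact_f] by (simp add: lincomb_def lact_sum lact_scale)
      also have "\<dots> = (R g *\<^sub>v v) $ i"
        using i v by (simp add: R_def scalar_prod_def lessThan_atLeast0 mult.commute)
      finally show "(R g *\<^sub>v v) $ i = coord (lact g (?lin v)) $ i" ..
    qed (simp add: R_def coord_def)
    then show ?thesis
      using lin_coord I lin_I g by metis
  qed
  have "is_rep G (n, R)"
  proof (rule is_repI)
    show "snd (n, R) (g \<otimes> h) = snd (n, R) g * snd (n, R) h" if gh: "g \<in> carrier G" "h \<in> carrier G" for g h
    proof -
      have "R (g \<otimes> h) = R g * R h"
      proof (rule mat_eqI_mult_vec[OF R mult_carrier_mat[OF R R]])
        fix v :: "'k vec" assume v: "v \<in> carrier_vec n"
        have Rv: "R h *\<^sub>v v \<in> carrier_vec n" "R g *\<^sub>v (R h *\<^sub>v v) \<in> carrier_vec n" "R (g \<otimes> h) *\<^sub>v v \<in> carrier_vec n"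
          using v R by (meson mult_mat_vec_carrier)+
        have "?lin (R (g \<otimes> h) *\<^sub>v v) = ?lin (R g *\<^sub>v (R h *\<^sub>v v))"
          using gh v Rv by (simp add: equivariant lact_mult)
        then show "R (g \<otimes> h) *\<^sub>v v = R g * R h *\<^sub>v v"
          using inj_onD[OF inj _ Rv(3,2)] assoc_mult_mat_vec[OF R R v] by simp
      qed
      then show ?thesis
        by simp
    qed
    have "R \<one> = 1\<^sub>m n"
    proof (rule mat_eqI_mult_vec[OF R one_carrier_mat])
      fix v :: "'k vec" assume v: "v \<in> carrier_vec n"
      have Rv: "R \<one> *\<^sub>v v \<in> carrier_vec n"
        using v R by (meson mult_mat_vec_carrier)
      have "?lin (R \<one> *\<^sub>v v) = ?lin v"
        using v lin_I I by (simp add: equivariant lact_one subset_iff)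
      then show "R \<one> *\<^sub>v v = 1\<^sub>m n *\<^sub>v v"
        using inj_onD[OF inj _ Rv v] v by simp
    qed
    then show "snd (n, R) \<one> = 1\<^sub>m (fst (n, R))"
      by simp
  qed (simp add: R)
  moreover have "?lin ` carrier_vec n = I"
    using lin_I lin_coord coord by (metis image_subset_iff subsetI subset_antisym image_eqI)
  ultimately show thesis
    using that[of "(n, R)" f] inj equivariant by simp
qed

text \<open>The right-hand side is the product of \<open>x\<close> with the element having
  coordinates \<open>v\<close>, expanded over the group. Thus the matrix action of \<open>x\<close>
  becomes left multiplication by \<open>x\<close>.\<close>

lemma lincomb_rep_ext:
  assumes "is_rep G V" "v \<in> carrier_vec (fst V)"
    and "\<And>g v. g \<in> carrier G \<Longrightarrow> v \<in> carrier_vec (fst V) \<Longrightarrow>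
      lincomb (fst V) f (snd V g *\<^sub>v v) = lact g (lincomb (fst V) f v)"
  shows "lincomb (fst V) f (rep_ext G V x *\<^sub>v v)
    = (\<Sum>g\<in>carrier G. ga_scale (x g) (lact g (lincomb (fst V) f v)))"
proof
  fix h
  have index: "(rep_ext G V x *\<^sub>v v) $ i = (\<Sum>g\<in>carrier G. x g * (snd V g *\<^sub>v v) $ i)" if "i < fst V" for i
  proof -
    have "(rep_ext G V x *\<^sub>v v) $ i = (\<Sum>k<fst V. \<Sum>g\<in>carrier G. x g * (snd V g $$ (i, k) * v $ k))"
      using that assms(2)
      by (simp add: scalar_prod_def lessThan_atLeast0 rep_ext_index sum_distrib_left mult_ac)
    also have "\<dots> = (\<Sum>g\<in>carrier G. x g * (\<Sum>k<fst V. snd V g $$ (i, k) * v $ k))"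
      by (subst sum.swap) (simp add: sum_distrib_left)
    also have "\<dots> = (\<Sum>g\<in>carrier G. x g * (snd V g *\<^sub>v v) $ i)"
    proof (intro sum.cong refl)
      fix g assume "g \<in> carrier G"
      then show "x g * (\<Sum>k<fst V. snd V g $$ (i, k) * v $ k) = x g * (snd V g *\<^sub>v v) $ i"
        using is_repD(1)[OF assms(1), of g] that assms(2)
        by (simp add: scalar_prod_def lessThan_atLeast0)
    qed
    finally show ?thesis .
  qed
  have "lincomb (fst V) f (rep_ext G V x *\<^sub>v v) h
      = (\<Sum>i<fst V. \<Sum>g\<in>carrier G. x g * ((snd V g *\<^sub>v v) $ i * f i h))"
    by (simp add: lincomb_apply index sum_distrib_right mult.assoc del: index_mult_mat_vec)
  also have "\<dots> = (\<Sum>g\<in>carrier G. x g * lincomb (fst V) f (snd V g *\<^sub>v v) h)"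
    by (subst sum.swap) (simp add: lincomb_apply sum_distrib_left)
  also have "\<dots> = (\<Sum>g\<in>carrier G. ga_scale (x g) (lact g (lincomb (fst V) f v))) h"
    using assms(2,3) by (simp add: sum_fun_apply)
  finally show "lincomb (fst V) f (rep_ext G V x *\<^sub>v v) h
      = (\<Sum>g\<in>carrier G. ga_scale (x g) (lact g (lincomb (fst V) f v))) h" .
qed

text \<open>An invariant subspace is carried by the equivariant injection to a left ideal inside
  \<open>I\<close>. Minimality leaves only 0 and \<open>I\<close>, and injectivity carries this back
  to the coordinate space.\<close>

lemma left_ideal_rep_irreducible:
  fixes I :: "('a \<Rightarrow> 'k::field) set"
  assumes I: "I \<noteq> {0}" "\<And>I'. left_ideal I' \<Longrightarrow> I' \<subseteq> I \<Longrightarrow> I' \<noteq> {0} \<Longrightarrow> I' = I"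
    and V: "is_rep G V" "inj_on (lincomb (fst V) f) (carrier_vec (fst V))"
      "lincomb (fst V) f ` carrier_vec (fst V) = I" "I \<subseteq> group_algebra G"
    and equivariant: "\<And>g v. g \<in> carrier G \<Longrightarrow> v \<in> carrier_vec (fst V) \<Longrightarrow>
      lincomb (fst V) f (snd V g *\<^sub>v v) = lact g (lincomb (fst V) f v)"
  shows "V \<in> irreps G"
proof -
  let ?n = "fst V" and ?lin = "lincomb (fst V) f"
  \<comment> \<open>In degree 0 the only vector is the zero vector, which would force
    \<open>I = {0}\<close>.\<close>
  have "?n \<noteq> 0"
  proof
    assume "?n = 0"
    then have "carrier_vec ?n = {0\<^sub>v ?n :: 'k vec}"
      by auto
    then have "I = {?lin (0\<^sub>v ?n)}"
      using V(3) by (metis image_empty image_insert)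
    with I(1) show False
      by simp
  qed
  moreover have "W = {0\<^sub>v ?n} \<or> W = carrier_vec ?n" if "invariant_subspace G V W" for W
  proof -
    have W: "W \<subseteq> carrier_vec ?n" "0\<^sub>v ?n \<in> W" "\<And>u w. u \<in> W \<Longrightarrow> w \<in> W \<Longrightarrow> u + w \<in> W"
      "\<And>c w. w \<in> W \<Longrightarrow> c \<cdot>\<^sub>v w \<in> W" "\<And>g w. g \<in> carrier G \<Longrightarrow> w \<in> W \<Longrightarrow> snd V g *\<^sub>v w \<in> W"
      using that by (auto simp: invariant_subspace_def)
    have sub: "?lin ` W \<subseteq> I"
      using V(3) W(1) by blast
    have "left_ideal (?lin ` W)"
      unfolding left_ideal_def
    proof (intro conjI ballI ga.subspaceI)
      show "0 \<in> ?lin ` W"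
        using W(2) lincomb_zero by (metis image_eqI)
      show "x + y \<in> ?lin ` W" if "x \<in> ?lin ` W" "y \<in> ?lin ` W" for x y
        using that W(1,3) by (auto simp: lincomb_add[symmetric] subset_iff)
      show "ga_scale c x \<in> ?lin ` W" if "x \<in> ?lin ` W" for c x
        using that W(1,4) by (auto simp: lincomb_smult[symmetric] subset_iff)
      show "lact g x \<in> ?lin ` W" if "g \<in> carrier G" "x \<in> ?lin ` W" for g x
        using that W(1,5) by (auto simp: equivariant[symmetric] subset_iff)
    qed (use sub V(4) in auto)
    then have "?lin ` W = {0} \<or> ?lin ` W = ?lin ` carrier_vec ?n"
      using I(2) sub V(3) by blast
    then show ?thesis
    proof
      assume "?lin ` W = {0}"
      then have "?lin ` W = ?lin ` {0\<^sub>v ?n}"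
        by simp
      then show ?thesis
        using inj_on_image_eq_iff[OF V(2) W(1)] by (metis W(1,2) empty_subsetI insert_subset subsetD)
    next
      assume "?lin ` W = ?lin ` carrier_vec ?n"
      then show ?thesis
        using inj_on_image_eq_iff[OF V(2) W(1)] by blast
    qed
  qed
  ultimately show ?thesis
    using V(1) by (auto simp: irreps_def irreducible_rep_def)
qed

text \<open>Averaging a linear projection onto \<open>I\<close> over the group gives a projection
  that commutes with left translations. Such a map is right multiplication by its value
  \<open>e\<close> at the neutral element, and it fixes \<open>I\<close>, so \<open>y = y e\<close>
  for every \<open>y\<close> in \<open>I\<close>.\<close>

lemma maschke_projection:
  fixes I :: "('a \<Rightarrow> 'k::field_char_0) set"
  assumes "left_ideal I"
  obtains e where "e \<in> I" "\<And>y. y \<in> I \<Longrightarrow> y = (\<Sum>g\<in>carrier G. ga_scale (y g) (lact g e))"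
proof -
  note I = assms[unfolded left_ideal_def]
  obtain p where p: "\<And>x. p x \<in> I" "\<And>x. x \<in> I \<Longrightarrow> p x = x"
    "\<And>x y. p (x + y) = p x + p y" "\<And>c x. p (ga_scale c x) = ga_scale c (p x)"
    using ga_projection_exists I by metis
  \<comment> \<open>The sum of the conjugates of \<open>p\<close> under translation; on
    \<open>I\<close> it is multiplication by the group order, which \<open>c\<close>
    inverts.\<close>
  define q where "q y = (\<Sum>g\<in>carrier G. lact g (p (lact (inv g) y)))" for y
  define c :: 'k where "c = inverse (of_nat (card (carrier G)))"
  have card: "of_nat (card (carrier G)) \<noteq> (0 :: 'k)"
    using one_closed by (auto simp: card_eq_0_iff)
  have q_I: "q y \<in> I" for y
    unfolding q_def using I p(1) by (intro ga.subspace_sum) auto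
  have q_id: "ga_scale c (q y) = y" if y: "y \<in> I" for y
  proof -
    have "lact g (p (lact (inv g) y)) = y" if g: "g \<in> carrier G" for g
    proof -
      have "p (lact (inv g) y) = lact (inv g) y"
        using I y g by (intro p(2)) auto
      then show ?thesis
        using I y g lact_mult[of g "inv g" y] by (simp add: lact_one subset_iff)
    qed
    then have "q y = (\<Sum>g\<in>carrier G. y)"
      by (simp add: q_def)
    then show ?thesis
      using card by (auto simp: fun_eq_iff sum_fun_apply c_def)
  qed
  have q_add: "q (x + y) = q x + q y" for x y
    by (simp add: q_def lact_add p(3) sum.distrib)
  have q_scale: "q (ga_scale a x) = ga_scale a (q x)" for a x
    by (simp add: q_def lact_scale p(4) ga.scale_sum_right)
  have q_lact: "q (lact h y) = lact h (q y)" if h: "h \<in> carrier G" for h y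
  proof -
    \<comment> \<open>Reindexing the average by \<open>h \<otimes> g\<close> lets the outer
      translation by \<open>h\<close> be pulled out, while the inner one cancels.\<close>
    have "q (lact h y) = (\<Sum>g\<in>carrier G. lact (h \<otimes> g) (p (lact (inv (h \<otimes> g)) (lact h y))))"
      unfolding q_def by (rule sum_translate[OF h, symmetric])
    also have "\<dots> = (\<Sum>g\<in>carrier G. lact h (lact g (p (lact (inv g) y))))"
    proof (intro sum.cong refl)
      fix g assume g: "g \<in> carrier G"
      have "inv g = inv (h \<otimes> g) \<otimes> h"
        using g h by (simp add: inv_mult_group m_assoc)
      then have "lact (inv (h \<otimes> g)) (lact h y) = lact (inv g) y"
        using g h by (simp add: lact_mult)
      then show "lact (h \<otimes> g) (p (lact (inv (h \<otimes> g)) (lact h y))) = lact h (lact g (p (lact (inv g) y)))"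
        using g h by (simp add: lact_mult)
    qed
    also have "\<dots> = lact h (q y)"
      by (simp add: q_def lact_sum)
    finally show ?thesis .
  qed
  have q_basis: "q (ga_basis g) = lact g (q (ga_basis \<one>))" if "g \<in> carrier G" for g
    using q_lact[OF that, of "ga_basis \<one>"] that by (simp add: lact_basis_one)
  show thesis
  proof (rule that[of "ga_scale c (q (ga_basis \<one>))"])
    show "ga_scale c (q (ga_basis \<one>)) \<in> I"
      using I q_I by (simp add: ga.subspace_scale)
    fix y assume y: "y \<in> I"
    have "y = ga_scale c (q y)"
      using q_id[OF y] by simp
    also have "q y = q (\<Sum>g\<in>carrier G. ga_scale (y g) (ga_basis g))"
      using y I by (intro arg_cong[where f = q] group_algebra_expand) auto
    also have "\<dots> = (\<Sum>g\<in>carrier G. q (ga_scale (y g) (ga_basis g)))"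
      by (rule additive_sum[where f = q]) (rule q_add)
    also have "\<dots> = (\<Sum>g\<in>carrier G. ga_scale (y g) (lact g (q (ga_basis \<one>))))"
      by (intro sum.cong refl) (metis q_scale q_basis)
    also have "ga_scale c \<dots> = (\<Sum>g\<in>carrier G. ga_scale (y g) (lact g (ga_scale c (q (ga_basis \<one>)))))"
      by (simp only: ga.scale_sum_right lact_scale ga.scale_scale mult.commute)
    finally show "y = (\<Sum>g\<in>carrier G. ga_scale (y g) (lact g (ga_scale c (q (ga_basis \<one>)))))" .
  qed
qed

text \<open>
  A minimal left ideal \<open>I\<close> annihilated by all irreducible representations would satisfy \<open>I I = 0\<close>,
  while by Maschke it is generated by an idempotent.
\<close>

theorem eq_0_if_irreps_vanish:
  fixes x :: "'a \<Rightarrow> 'k::field_char_0"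
  assumes "x \<in> group_algebra G" "\<And>W. W \<in> irreps G \<Longrightarrow> rep_ext G W x = 0\<^sub>m (fst W) (fst W)"
  shows "x = 0"
proof (rule ccontr)
  assume "x \<noteq> 0"
  define J :: "('a \<Rightarrow> 'k) set"
    where "J = {x \<in> group_algebra G. \<forall>W\<in>irreps G. rep_ext G W x = 0\<^sub>m (fst W) (fst W)}"
  have "left_ideal J"
    unfolding left_ideal_def
  proof (intro conjI ballI ga.subspaceI)
    show "0 \<in> J"
      by (auto simp: J_def rep_ext_def ga.subspace_0[OF subspace_group_algebra])
    show "x + y \<in> J" if "x \<in> J" "y \<in> J" for x y
      using that by (auto simp: J_def rep_ext_add ga.subspace_add[OF subspace_group_algebra])
    show "ga_scale c x \<in> J" if "x \<in> J" for c x
    proof -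
      have "rep_ext G W (ga_scale c x) = c \<cdot>\<^sub>m rep_ext G W x" for W
        by (rule eq_matI) (auto simp: rep_ext_index sum_distrib_left mult.assoc)
      then show ?thesis
        using that by (auto simp: J_def ga.subspace_scale[OF subspace_group_algebra])
    qed
    show "lact g x \<in> J" if g: "g \<in> carrier G" and x: "x \<in> J" for g x
    proof -
      have "rep_ext G W (lact g x) = 0\<^sub>m (fst W) (fst W)" if W: "W \<in> irreps G" for W
      proof -
        note WG = is_repD[OF irreducible_repD[OF W]]
        have "rep_ext G W (lact g x) = snd W g * rep_ext G W x"
        proof (rule eq_matI)
          fix i j assume "i < dim_row (snd W g * rep_ext G W x)" "j < dim_col (snd W g * rep_ext G W x)"
          then have ij: "i < fst W" "j < fst W"
            using WG(1)[OF g] by auto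
          have "rep_ext G W (lact g x) $$ (i, j)
              = (\<Sum>h\<in>carrier G. lact g x (g \<otimes> h) * snd W (g \<otimes> h) $$ (i, j))"
            unfolding rep_ext_index[OF ij] by (rule sum_translate[OF g, symmetric])
          also have "\<dots> = (\<Sum>h\<in>carrier G. x h * (snd W g * snd W h) $$ (i, j))"
            using g by (intro sum.cong refl) (auto simp: lact_def WG(2) m_assoc[symmetric])
          also have "\<dots> = (snd W g * rep_ext G W x) $$ (i, j)"
            by (rule mult_rep_ext_index[OF irreducible_repD[OF W] WG(1)[OF g] ij, symmetric])
          finally show "rep_ext G W (lact g x) $$ (i, j) = (snd W g * rep_ext G W x) $$ (i, j)" .
        qed (use WG(1)[OF g] in auto)
        then show ?thesis
          using x W WG(1)[OF g] by (auto simp: J_def)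
      qed
      then show ?thesis
        by (simp add: J_def lact_group_algebra)
    qed
  qed (auto simp: J_def)
  moreover have "x \<in> J"
    using assms by (simp add: J_def)
  ultimately have J: "left_ideal J" "J \<noteq> {0}"
    using \<open>x \<noteq> 0\<close> by auto
  obtain I where I: "left_ideal I" "I \<subseteq> J" "I \<noteq> {0}"
    "\<And>I'. left_ideal I' \<Longrightarrow> I' \<subseteq> I \<Longrightarrow> I' \<noteq> {0} \<Longrightarrow> I' = I"
    by (rule minimal_left_ideal_exists[OF J], rule that)
  obtain V f where V: "is_rep G V" "inj_on (lincomb (fst V) f) (carrier_vec (fst V))"
    "lincomb (fst V) f ` carrier_vec (fst V) = I"
    "\<And>g v. g \<in> carrier G \<Longrightarrow> v \<in> carrier_vec (fst V) \<Longrightarrow>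
      lincomb (fst V) f (snd V g *\<^sub>v v) = lact g (lincomb (fst V) f v)"
    by (rule left_ideal_rep[OF I(1)], rule that)
  have "V \<in> irreps G"
    using I(1) by (intro left_ideal_rep_irreducible[OF I(3,4) V(1-3) _ V(4)]) (simp_all add: left_ideal_def)
  \<comment> \<open>Multiplication by \<open>y\<close> on \<open>I\<close> is the action of
    \<open>y\<close> on \<open>V\<close>. This is zero because \<open>y\<close> lies in
    \<open>J\<close> and \<open>V\<close> is irreducible.\<close>
  then have annihilate: "(\<Sum>g\<in>carrier G. ga_scale (y g) (lact g z)) = 0" if y: "y \<in> I" and z: "z \<in> I" for y z
  proof -
    obtain v where v: "v \<in> carrier_vec (fst V)" "z = lincomb (fst V) f v"
      using z V(3) by blast
    have "rep_ext G V y = 0\<^sub>m (fst V) (fst V)"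
      using y I(2) \<open>V \<in> irreps G\<close> by (auto simp: J_def)
    then show ?thesis
      using lincomb_rep_ext[OF V(1) v(1) V(4), of y] v by (simp add: zero_mult_mat_vec)
  qed
  obtain e where e: "e \<in> I" "\<And>y. y \<in> I \<Longrightarrow> y = (\<Sum>g\<in>carrier G. ga_scale (y g) (lact g e))"
    by (rule maschke_projection[OF I(1)], rule that)
  have "I \<subseteq> {0}"
  proof
    fix y assume "y \<in> I"
    from trans[OF e(2)[OF this] annihilate[OF this e(1)]] show "y \<in> {0}"
      by simp
  qed
  moreover have "{0} \<subseteq> I"
    using I(1) by (simp add: left_ideal_def ga.subspace_0)
  ultimately show False
    using I(3) by (metis subset_antisym)
qed

text \<open>The argument is by duality: a proper span would be killed by a linear form that is
  nonzero on the group algebra, and the elements \<open>inv_coeff V i j\<close> are enough to test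
  such a form.\<close>

theorem group_algebra_eq_span_supported:
  "(group_algebra G :: ('a \<Rightarrow> 'k::field_char_0) set) = ga.span (\<Union>V\<in>irreps G. supported_on G {V})"
    (is "_ = ?N")
proof (intro subset_antisym subsetI)
  fix x :: "'a \<Rightarrow> 'k" assume x: "x \<in> group_algebra G"
  show "x \<in> ?N"
  proof (rule ccontr)
    assume not_mem: "x \<notin> ?N"
    obtain f :: "('a \<Rightarrow> 'k) \<Rightarrow> 'k" where f: "\<And>y z. f (y + z) = f y + f z"
      "\<And>c y. f (ga_scale c y) = c * f y" "\<And>y. y \<in> ?N \<Longrightarrow> f y = 0" "f x \<noteq> 0"
      by (rule linear_form_separating[OF ga.subspace_span not_mem], rule that)
    have f_expand: "f y = (\<Sum>g\<in>carrier G. y g * f (ga_basis g))" if "y \<in> group_algebra G" for y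
    proof -
      have "f y = f (\<Sum>g\<in>carrier G. ga_scale (y g) (ga_basis g))"
        by (rule arg_cong[where f = f]) (rule group_algebra_expand[OF that])
      also have "\<dots> = (\<Sum>g\<in>carrier G. f (ga_scale (y g) (ga_basis g)))"
        by (rule additive_sum[where f = f]) (rule f(1))
      finally show ?thesis
        by (simp add: f(2))
    qed
    \<comment> \<open>The inversion is chosen so that the entry \<open>(i, j)\<close> of the
      component of \<open>z\<close> at \<open>V\<close> equals the value of \<open>f\<close> at
      \<open>inv_coeff V i j\<close>.\<close>
    define z where "z g = (if g \<in> carrier G then f (ga_basis (inv g)) else 0)" for g
    have "z = 0"
    proof (rule eq_0_if_irreps_vanish)
      show "z \<in> group_algebra G"
        by (simp add: z_def group_algebra_def)
      fix V :: "('a, 'k) mrep" assume V: "V \<in> irreps G"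
      show "rep_ext G V z = 0\<^sub>m (fst V) (fst V)"
      proof (rule eq_matI)
        fix i j assume "i < dim_row (0\<^sub>m (fst V) (fst V) :: 'k mat)" "j < dim_col (0\<^sub>m (fst V) (fst V) :: 'k mat)"
        then have ij: "i < fst V" "j < fst V" by auto
        have supp: "inv_coeff V i j \<in> supported_on G {V}"
          by (rule inv_coeff_supported_on[OF V ij])
        have "rep_ext G V z $$ (i, j) = (\<Sum>g\<in>carrier G. f (ga_basis (inv g)) * snd V g $$ (i, j))"
          using ij by (simp add: rep_ext_index z_def)
        also have "\<dots> = (\<Sum>g\<in>carrier G. inv_coeff V i j g * f (ga_basis g))"
          by (rule sum.reindex_bij_witness[of _ "\<lambda>g. inv g" "\<lambda>g. inv g"]) (auto simp: inv_coeff_def)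
        also have "\<dots> = f (inv_coeff V i j)"
          using supp by (subst f_expand) (auto simp: supported_on_def)
        also have "\<dots> = 0"
          using supp V by (intro f(3) ga.span_base) blast
        finally show "rep_ext G V z $$ (i, j) = 0\<^sub>m (fst V) (fst V) $$ (i, j)"
          using ij by simp
      qed auto
    qed
    then have "z h = 0" for h
      by simp
    from this[unfolded z_def] have "f (ga_basis g) = 0" if "g \<in> carrier G" for g
      using that by (metis inv_closed inv_inv)
    then have "f x = 0"
      using f_expand[OF x] by simp
    with f(4) show False ..
  qed
next
  fix x :: "'a \<Rightarrow> 'k" assume "x \<in> ?N"
  moreover have "?N \<subseteq> group_algebra G"
    by (intro ga.span_minimal subspace_group_algebra) (auto simp: supported_on_def)
  ultimately show "x \<in> group_algebra G"
    by blast
qed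

end

section \<open>The antiautomorphism and the sharp operation\<close>

text \<open>The law \<open>alpha_tau\<close> is what makes both \<open>S\<close> and the sharp
  operation involutive: applying either twice introduces the factor \<alpha>(g) /
  \<alpha>(\<tau>(g)).\<close>

locale twisted_group = fin_group G for G (structure) +
  fixes \<alpha> :: "'a \<Rightarrow> 'k::field_char_0" and \<tau> :: "'a \<Rightarrow> 'a"
  assumes alpha_hom: "\<alpha> \<in> hom G (mult_group TYPE('k))"
    and tau_iso: "\<tau> \<in> iso G G"
    and tau_tau [simp]: "g \<in> carrier G \<Longrightarrow> \<tau> (\<tau> g) = g"
    and alpha_tau [simp]: "g \<in> carrier G \<Longrightarrow> \<alpha> (\<tau> g) = \<alpha> g"
begin

section \<open>The twisted inversion and the antiautomorphism \<open>S\<close>\<close>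

lemma tau_closed [simp]: "g \<in> carrier G \<Longrightarrow> \<tau> g \<in> carrier G"
  using tau_iso by (auto simp: iso_def hom_def)

lemma tau_mult: "g \<in> carrier G \<Longrightarrow> h \<in> carrier G \<Longrightarrow> \<tau> (g \<otimes> h) = \<tau> g \<otimes> \<tau> h"
  using tau_iso by (auto simp: iso_def hom_def)

lemma tau_inv: "g \<in> carrier G \<Longrightarrow> \<tau> (inv g) = inv (\<tau> g)"
  using group_hom.hom_inv[of G G \<tau> g] tau_iso
  by (simp add: group_hom_def group_hom_axioms_def iso_def)

lemma alpha_mult: "g \<in> carrier G \<Longrightarrow> h \<in> carrier G \<Longrightarrow> \<alpha> (g \<otimes> h) = \<alpha> g * \<alpha> h"
  using alpha_hom by (auto simp: hom_def mult_group_def)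

lemma alpha_nonzero: "g \<in> carrier G \<Longrightarrow> \<alpha> g \<noteq> 0"
  using alpha_hom by (auto simp: hom_def mult_group_def)

lemma alpha_one [simp]: "\<alpha> \<one> = 1"
  using alpha_mult[of \<one> \<one>] alpha_nonzero[of \<one>] by simp

lemma alpha_inv [simp]: "g \<in> carrier G \<Longrightarrow> \<alpha> (inv g) = inverse (\<alpha> g)"
  using alpha_mult[of g "inv g"] by (simp add: inverse_unique)

definition twinv :: "'a \<Rightarrow> 'a" where
  "twinv g = inv (\<tau> g)"

lemma twinv_closed [simp]: "g \<in> carrier G \<Longrightarrow> twinv g \<in> carrier G"
  by (simp add: twinv_def)

lemma twinv_twinv [simp]: "g \<in> carrier G \<Longrightarrow> twinv (twinv g) = g"
  by (simp add: twinv_def tau_inv)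

lemma twinv_mult: "g \<in> carrier G \<Longrightarrow> h \<in> carrier G \<Longrightarrow> twinv (g \<otimes> h) = twinv h \<otimes> twinv g"
  by (simp add: twinv_def tau_mult inv_mult_group)

lemma twinv_one [simp]: "twinv \<one> = \<one>"
  using twinv_mult[of \<one> "twinv \<one>"] twinv_twinv[of \<one>] by (simp del: twinv_twinv)

lemma alpha_twinv [simp]: "g \<in> carrier G \<Longrightarrow> \<alpha> (twinv g) = inverse (\<alpha> g)"
  by (simp add: twinv_def)

text \<open>The linear extension of g -> \<alpha>(g) \<tau>(g)^-1, given by coefficients: the only
  group element sent to a multiple of \<open>g\<close> is \<open>twinv g\<close>, since
  \<open>twinv\<close> is an involution.\<close>

definition S :: "('a \<Rightarrow> 'k) \<Rightarrow> 'a \<Rightarrow> 'k" where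
  "S x = (\<lambda>g. if g \<in> carrier G then \<alpha> (twinv g) * x (twinv g) else 0)"

lemma S_diff: "S (x - y) = S x - S y"
  by (auto simp: S_def fun_eq_iff algebra_simps)

lemma S_add: "S (x + y) = S x + S y"
  by (auto simp: S_def fun_eq_iff algebra_simps)

lemma S_scale: "S (ga_scale c x) = ga_scale c (S x)"
  by (auto simp: S_def fun_eq_iff)

lemma S_zero: "S 0 = 0"
  by (auto simp: S_def fun_eq_iff)

lemma S_group_algebra: "S x \<in> group_algebra G"
  by (auto simp: S_def group_algebra_def)

lemma S_S: "x \<in> group_algebra G \<Longrightarrow> S (S x) = x"
  by (auto simp: S_def fun_eq_iff group_algebra_def alpha_nonzero)

lemma S_basis:
  assumes "g \<in> carrier G"
  shows "S (ga_basis g) = ga_scale (\<alpha> g) (ga_basis (\<tau> (inv g)))"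
proof
  fix h
  have "twinv h = g \<longleftrightarrow> h = \<tau> (inv g)" if "h \<in> carrier G"
    using that assms twinv_twinv[of h] twinv_twinv[of g] by (auto simp: twinv_def tau_inv)
  then show "S (ga_basis g) h = ga_scale (\<alpha> g) (ga_basis (\<tau> (inv g))) h"
    using assms by (auto simp: S_def ga_basis_def)
qed

lemma S_ga_mult: "S (ga_mult G x y) = ga_mult G (S y) (S x)"
proof
  fix g
  show "S (ga_mult G x y) g = ga_mult G (S y) (S x) g"
  proof (cases "g \<in> carrier G")
    case True
    have "S (ga_mult G x y) g
        = (\<Sum>(h, k) | h \<in> carrier G \<and> k \<in> carrier G \<and> h \<otimes> k = twinv g. \<alpha> (twinv g) * (x h * y k))"
      using True by (simp add: S_def ga_mult_def sum_distrib_left case_prod_unfold)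
    also have "\<dots> = (\<Sum>(h, k) | h \<in> carrier G \<and> k \<in> carrier G \<and> h \<otimes> k = g. S y h * S x k)"
    \<comment> \<open>The map \<open>(h, k) \<mapsto> (twinv k, twinv h)\<close> is its own inverse
      and exchanges factorisations of \<open>twinv g\<close> with factorisations of
      \<open>g\<close>.\<close>
    proof (rule sum.reindex_bij_witness[of _ "\<lambda>(h, k). (twinv k, twinv h)" "\<lambda>(h, k). (twinv k, twinv h)"], goal_cases)
      case (1 a)
      then show ?case by auto
    next
      case (2 a)
      then show ?case
        using True by (auto simp: twinv_mult[symmetric])
    next
      case (3 a)
      then show ?case by auto
    next
      case (4 a)
      then show ?case
        by (auto simp: twinv_mult)
    next
      case (5 a)
      then have "\<alpha> (twinv g) = \<alpha> (fst a) * \<alpha> (snd a)"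
        by (auto simp: alpha_mult[symmetric] simp del: alpha_twinv)
      with 5 show ?case
        by (auto simp: S_def)
    qed
    finally show ?thesis
      by (simp add: ga_mult_def)
  next
    case False
    then have "ga_mult G u v g = 0" for u v :: "'a \<Rightarrow> 'k"
      unfolding ga_mult_def by (intro sum.neutral) auto
    with False show ?thesis
      by (simp add: S_def)
  qed
qed

section \<open>The twisted dual of a representation\<close>

abbreviation sh :: "('a, 'k) mrep \<Rightarrow> ('a, 'k) mrep" where
  "sh \<equiv> sharp G \<alpha> \<tau>"

lemma fst_sharp [simp]: "fst (sh V) = fst V"
  by (simp add: sharp_def)

lemma snd_sharp: "snd (sh V) g = \<alpha> g \<cdot>\<^sub>m transpose_mat (snd V (twinv g))"
  by (simp add: sharp_def twinv_def)

text \<open>Transposition and \<open>twinv\<close> both reverse products, so together they preserve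
  them; the scalar \<alpha> is multiplicative.\<close>

lemma is_rep_sharp:
  assumes "is_rep G V"
  shows "is_rep G (sh V)"
proof (rule is_repI)
  note VG = is_repD[OF assms]
  show "snd (sh V) g \<in> carrier_mat (fst (sh V)) (fst (sh V))" if "g \<in> carrier G" for g
    using VG(1)[of "twinv g"] that by (simp add: snd_sharp)
  show "snd (sh V) (g \<otimes> h) = snd (sh V) g * snd (sh V) h" if gh: "g \<in> carrier G" "h \<in> carrier G" for g h
  proof -
    let ?n = "fst V"
    have A: "snd V (twinv g) \<in> carrier_mat ?n ?n" and B: "snd V (twinv h) \<in> carrier_mat ?n ?n"
      using VG(1) gh by auto
    have smult_smult: "(\<alpha> g * \<alpha> h) \<cdot>\<^sub>m M = \<alpha> h \<cdot>\<^sub>m (\<alpha> g \<cdot>\<^sub>m M)" for M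
      by (rule eq_matI) auto
    have "snd (sh V) (g \<otimes> h) = (\<alpha> g * \<alpha> h) \<cdot>\<^sub>m transpose_mat (snd V (twinv h) * snd V (twinv g))"
      using gh by (simp add: snd_sharp alpha_mult twinv_mult VG(2))
    also have "transpose_mat (snd V (twinv h) * snd V (twinv g))
        = transpose_mat (snd V (twinv g)) * transpose_mat (snd V (twinv h))"
      using A B by (rule transpose_mult[rotated])
    also have "(\<alpha> g * \<alpha> h) \<cdot>\<^sub>m \<dots> = snd (sh V) g * snd (sh V) h"
      unfolding snd_sharp using A B
      by (simp add: mult_smult_distrib[of _ ?n ?n _ ?n] mult_smult_assoc_mat[of _ ?n ?n _ ?n] smult_smult)
    finally show ?thesis .
  qed
  show "snd (sh V) \<one> = 1\<^sub>m (fst (sh V))"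
    by (rule eq_matI) (auto simp: snd_sharp VG(3))
qed

lemma snd_sharp_sharp:
  assumes "is_rep G V" "g \<in> carrier G"
  shows "snd (sh (sh V)) g = snd V g"
  using is_repD(1)[OF assms] assms(2) alpha_nonzero[of g]
  by (auto simp: snd_sharp intro!: eq_matI)

text \<open>This ties \<open>S\<close> to the sharp operation. On a group element, the matrix of
  \<open>S\<close> of \<open>g\<close> at \<open>V\<close> is \<alpha>(g) times that of
  \<open>twinv g\<close>, which is the transpose of the matrix of \<open>g\<close> at
  \<open>sh V\<close>; reindexing the sum by \<open>twinv\<close> extends this linearly.\<close>

lemma rep_ext_S:
  assumes "is_rep G V"
  shows "rep_ext G V (S x) = transpose_mat (rep_ext G (sh V) x)"
proof (rule eq_matI)
  fix i j assume "i < dim_row (transpose_mat (rep_ext G (sh V) x))"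
    "j < dim_col (transpose_mat (rep_ext G (sh V) x))"
  then have ij: "i < fst V" "j < fst V"
    by auto
  have index: "snd (sh V) g $$ (j, i) = \<alpha> g * snd V (twinv g) $$ (i, j)" if "g \<in> carrier G" for g
    using is_repD(1)[OF assms, of "twinv g"] that ij by (simp add: snd_sharp)
  have "rep_ext G V (S x) $$ (i, j) = (\<Sum>g\<in>carrier G. \<alpha> (twinv g) * x (twinv g) * snd V g $$ (i, j))"
    using ij by (simp add: rep_ext_index S_def)
  also have "\<dots> = (\<Sum>g\<in>carrier G. x g * snd (sh V) g $$ (j, i))"
    by (rule sum.reindex_bij_witness[of _ twinv twinv]) (auto simp: index simp del: alpha_twinv)
  also have "\<dots> = transpose_mat (rep_ext G (sh V) x) $$ (i, j)"
    using ij by (simp add: rep_ext_index)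
  finally show "rep_ext G V (S x) $$ (i, j) = transpose_mat (rep_ext G (sh V) x) $$ (i, j)" .
qed auto

text \<open>The annihilator of an invariant subspace \<open>U\<close> of \<open>sh V\<close> is
  invariant under \<open>V\<close>, hence zero or everything. In the first case \<open>U\<close> is
  the whole space, because a proper subspace is killed by some nonzero vector; in the second
  \<open>U\<close> is zero.\<close>

lemma irreducible_sharp:
  assumes V: "V \<in> irreps G"
  shows "sh V \<in> irreps G"
proof -
  let ?n = "fst V"
  note VG = is_repD[OF irreducible_repD[OF V]]
  have "U = {0\<^sub>v ?n} \<or> U = carrier_vec ?n" if "invariant_subspace G (sh V) U" for U
  proof -
    have U: "U \<subseteq> carrier_vec ?n" "0\<^sub>v ?n \<in> U" "\<And>u w. u \<in> U \<Longrightarrow> w \<in> U \<Longrightarrow> u + w \<in> U"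
      "\<And>c u. u \<in> U \<Longrightarrow> c \<cdot>\<^sub>v u \<in> U" "\<And>g u. g \<in> carrier G \<Longrightarrow> u \<in> U \<Longrightarrow> snd (sh V) g *\<^sub>v u \<in> U"
      using that by (auto simp: invariant_subspace_def)
    \<comment> \<open>the annihilator of \<open>U\<close>, invariant under \<open>V\<close> itself\<close>
    define A where "A = {v \<in> carrier_vec ?n. \<forall>u\<in>U. u \<bullet> v = 0}"
    have "invariant_subspace G V A"
      unfolding invariant_subspace_def
    proof (intro conjI ballI allI)
      show "0\<^sub>v ?n \<in> A"
        using U(1) by (auto simp: A_def)
      show "v + w \<in> A" if "v \<in> A" "w \<in> A" for v w
        using that U(1) by (auto simp: A_def scalar_prod_add_distrib[of _ ?n] subset_iff)
      show "c \<cdot>\<^sub>v v \<in> A" if "v \<in> A" for c v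
        using that U(1) by (auto simp: A_def scalar_prod_smult_distrib[of _ ?n] subset_iff)
      show "snd V g *\<^sub>v v \<in> A" if g: "g \<in> carrier G" and v: "v \<in> A" for g v
      proof -
        have "u \<bullet> (snd V g *\<^sub>v v) = 0" if u: "u \<in> U" for u
        proof -
          have uv: "u \<in> carrier_vec ?n" "v \<in> carrier_vec ?n"
            using u U(1) v by (auto simp: A_def)
          have "snd (sh V) (twinv g) *\<^sub>v u = \<alpha> (twinv g) \<cdot>\<^sub>v (transpose_mat (snd V g) *\<^sub>v u)"
            using VG(1)[OF g] uv g by (simp add: snd_sharp smult_mat_mult_vec[of _ ?n ?n])
          then have "\<alpha> (twinv g) * ((transpose_mat (snd V g) *\<^sub>v u) \<bullet> v) = (snd (sh V) (twinv g) *\<^sub>v u) \<bullet> v"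
            using VG(1)[OF g] uv by simp
          also have "\<dots> = 0"
            using U(5)[OF twinv_closed[OF g] u] v by (simp add: A_def)
          finally show ?thesis
            using transpose_vec_mult_scalar[OF VG(1)[OF g] uv(2,1)] alpha_nonzero[OF twinv_closed[OF g]]
            by simp
        qed
        moreover have "snd V g *\<^sub>v v \<in> carrier_vec ?n"
          using VG(1)[OF g] v by (auto simp: A_def)
        ultimately show ?thesis
          by (simp add: A_def)
      qed
    qed (auto simp: A_def)
    then have "A = {0\<^sub>v ?n} \<or> A = carrier_vec ?n"
      using V by (auto simp: irreps_def irreducible_rep_def)
    then show ?thesis
    proof
      assume A: "A = {0\<^sub>v ?n}"
      have "w \<in> U" if w: "w \<in> carrier_vec ?n" for w
      proof (rule ccontr)
        assume "w \<notin> U"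
        then obtain v where v: "v \<in> carrier_vec ?n" "v \<noteq> 0\<^sub>v ?n" "\<And>u. u \<in> U \<Longrightarrow> v \<bullet> u = 0"
          using annihilating_vec_exists[OF U(1-4) w] by blast
        then have "v \<in> A"
          using U(1) comm_scalar_prod[of v ?n] by (auto simp: A_def subset_iff)
        with A v(2) show False
          by simp
      qed
      with U(1) show ?thesis
        by blast
    next
      assume A: "A = carrier_vec ?n"
      have "u = 0\<^sub>v ?n" if u: "u \<in> U" for u
      proof (rule eq_vecI)
        fix i assume "i < dim_vec (0\<^sub>v ?n :: 'k vec)"
        then have i: "i < ?n" by simp
        have "unit_vec ?n i \<in> A"
          by (simp add: A)
        then have "u \<bullet> unit_vec ?n i = 0"
          using u by (simp add: A_def)
        then show "u $ i = 0\<^sub>v ?n $ i"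
          using i by simp
      qed (use u U(1) in auto)
      with U(2) show ?thesis
        by blast
    qed
  qed
  then show ?thesis
    using V is_rep_sharp[OF irreducible_repD[OF V]] by (auto simp: irreps_def irreducible_rep_def)
qed

text \<open>The operation is contravariant: the transpose of an isomorphism from \<open>V\<close> to
  \<open>W\<close> intertwines the twisted duals in the opposite direction.\<close>

lemma rep_iso_sharp:
  assumes "rep_iso G V W" "is_rep G V" "is_rep G W"
  shows "rep_iso G (sh W) (sh V)"
proof -
  obtain P Q where PQ: "fst V = fst W" "P \<in> carrier_mat (fst W) (fst W)" "Q \<in> carrier_mat (fst W) (fst W)"
    "P * Q = 1\<^sub>m (fst W)" "Q * P = 1\<^sub>m (fst W)" "\<And>g. g \<in> carrier G \<Longrightarrow> P * snd V g = snd W g * P"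
    by (rule rep_isoE[OF assms(1)], rule that)
  let ?n = "fst W"
  show ?thesis
  proof (rule rep_isoI[of _ _ "transpose_mat P" "transpose_mat Q"])
    show "transpose_mat P * transpose_mat Q = 1\<^sub>m (fst (sh V))"
      using transpose_mult[OF PQ(3,2)] PQ(1,5) by simp
    show "transpose_mat Q * transpose_mat P = 1\<^sub>m (fst (sh V))"
      using transpose_mult[OF PQ(2,3)] PQ(1,4) by simp
    fix g assume g: "g \<in> carrier G"
    have A: "snd V (twinv g) \<in> carrier_mat ?n ?n" and B: "snd W (twinv g) \<in> carrier_mat ?n ?n"
      using is_repD(1)[OF assms(2)] is_repD(1)[OF assms(3)] PQ(1) g by auto
    have "transpose_mat P * transpose_mat (snd W (twinv g)) = transpose_mat (snd V (twinv g)) * transpose_mat P"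
      using transpose_mult[OF B PQ(2)] transpose_mult[OF PQ(2) A] PQ(6)[of "twinv g"] g by simp
    then show "transpose_mat P * snd (sh W) g = snd (sh V) g * transpose_mat P"
      using PQ(2) A B
      by (simp add: snd_sharp mult_smult_distrib[of _ ?n ?n _ ?n] mult_smult_assoc_mat[of _ ?n ?n _ ?n])
  qed (use PQ(1-3) in auto)
qed

section \<open>The eigenspace of \<open>S\<close> for the eigenvalue -1\<close>

definition skew_part :: "('a \<Rightarrow> 'k) set" where
  "skew_part = {x \<in> group_algebra G. S x = - x}"

lemma subspace_skew_part: "ga.subspace skew_part"
proof (rule ga.subspaceI)
  note ga = ga.subspace_0[OF subspace_group_algebra] ga.subspace_add[OF subspace_group_algebra]
    ga.subspace_scale[OF subspace_group_algebra]
  show "0 \<in> skew_part"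
    by (simp add: skew_part_def S_zero ga)
  show "x + y \<in> skew_part" if "x \<in> skew_part" "y \<in> skew_part" for x y
    using that by (simp add: skew_part_def S_add ga)
  show "ga_scale c x \<in> skew_part" if "x \<in> skew_part" for c x
    using that by (simp add: skew_part_def S_scale ga)
qed

lemma diff_S_skew_part:
  assumes "x \<in> group_algebra G"
  shows "x - S x \<in> skew_part"
  using assms ga.subspace_diff[OF subspace_group_algebra assms S_group_algebra]
  by (simp add: skew_part_def S_diff S_S)

lemma skew_part_eq_half_diff:
  assumes "x \<in> skew_part"
  shows "x = ga_scale (1 / 2) (x - S x)"
proof
  fix g
  have "S x g = - x g"
    using assms by (simp add: skew_part_def)
  then show "x g = ga_scale (1 / 2) (x - S x) g"
    by simp
qed

text \<open>As \<open>S\<close> reverses products, S[x, y] = [S y, S x] = [y, x] = -[x, y] for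
  \<open>x\<close> and \<open>y\<close> in the eigenspace.\<close>

lemma lie_subalgebra_skew_part: "lie_subalgebra G skew_part"
  unfolding lie_subalgebra_def
proof (intro conjI ballI)
  show "skew_part \<subseteq> group_algebra G"
    by (auto simp: skew_part_def)
  show "ga.subspace skew_part"
    by (rule subspace_skew_part)
  fix x y assume xy: "x \<in> skew_part" "y \<in> skew_part"
  have closed: "ga_mult G u v \<in> group_algebra G" for u v :: "'a \<Rightarrow> 'k"
  proof -
    have "ga_mult G u v g = 0" if "g \<notin> carrier G" for g
      unfolding ga_mult_def using that by (intro sum.neutral) auto
    then show ?thesis
      by (simp add: group_algebra_def)
  qed
  have minus: "ga_mult G (- u) (- v) = ga_mult G u v" for u v :: "'a \<Rightarrow> 'k"
    by (simp add: ga_mult_def)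
  have "S (ga_mult G x y - ga_mult G y x) = - (ga_mult G x y - ga_mult G y x)"
    using xy by (simp add: S_diff S_ga_mult skew_part_def minus)
  then show "ga_mult G x y - ga_mult G y x \<in> skew_part"
    by (simp add: skew_part_def ga.subspace_diff[OF subspace_group_algebra closed closed])
qed

text \<open>The generators are the elements \<open>ga_basis g - S (ga_basis g)\<close>, which lie in
  the eigenspace because \<open>S\<close> is an involution. Conversely,
  \<open>x = (x - S x) / 2\<close> there, and expanding \<open>x\<close> over the group writes this
  as a combination of generators.\<close>

lemma lie_L_eq_skew_part: "lie_L G \<alpha> \<tau> = skew_part"
proof -
  have L: "lie_L G \<alpha> \<tau> = ga.span {ga_basis g - S (ga_basis g) | g. g \<in> carrier G}"
    by (simp add: lie_L_def setcompr_eq_image S_basis cong: image_cong_simp)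
  have "ga.span {ga_basis g - S (ga_basis g) | g. g \<in> carrier G} \<subseteq> skew_part"
  proof (rule ga.span_minimal[OF _ subspace_skew_part], clarify)
    fix g assume "g \<in> carrier G"
    then have "ga_basis g \<in> (group_algebra G :: ('a \<Rightarrow> 'k) set)"
      by (auto simp: ga_basis_def group_algebra_def)
    then show "ga_basis g - S (ga_basis g) \<in> skew_part"
      by (rule diff_S_skew_part)
  qed
  moreover have "x \<in> ga.span {ga_basis g - S (ga_basis g) | g. g \<in> carrier G}" if x: "x \<in> skew_part" for x
  proof -
    define D where "D y = y - S y" for y
    have D_add: "D (y + z) = D y + D z" for y z
      by (simp add: D_def S_add)
    have D_scale: "D (ga_scale c y) = ga_scale c (D y)" for c y
      by (simp add: D_def S_scale ga.scale_right_diff_distrib)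
    have "x = ga_scale (1 / 2) (D x)"
      unfolding D_def by (rule skew_part_eq_half_diff[OF x])
    also have "D x = D (\<Sum>g\<in>carrier G. ga_scale (x g) (ga_basis g))"
      using x by (intro arg_cong[where f = D] group_algebra_expand) (simp add: skew_part_def)
    also have "\<dots> = (\<Sum>g\<in>carrier G. D (ga_scale (x g) (ga_basis g)))"
      by (rule additive_sum[where f = D]) (rule D_add)
    also have "\<dots> = (\<Sum>g\<in>carrier G. ga_scale (x g) (D (ga_basis g)))"
      by (simp add: D_scale)
    also have "ga_scale (1 / 2) \<dots> \<in> ga.span {ga_basis g - S (ga_basis g) | g. g \<in> carrier G}"
      unfolding D_def by (intro ga.span_scale ga.span_sum ga.span_base) blast
    finally show ?thesis .
  qed
  ultimately show ?thesis
    unfolding L by blast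
qed

section \<open>Isomorphism classes and their orbits under the sharp operation\<close>

lemma rep_iso_sharp_sharp:
  assumes "is_rep G V"
  shows "rep_iso G (sh (sh V)) V"
proof -
  have carrier: "snd V g \<in> carrier_mat (fst V) (fst V)" if "g \<in> carrier G" for g
    using is_repD(1)[OF assms that] .
  have "1\<^sub>m (fst V) * snd (sh (sh V)) g = snd V g * 1\<^sub>m (fst V)" if "g \<in> carrier G" for g
    using carrier[OF that] by (simp add: snd_sharp_sharp[OF assms that])
  then show ?thesis
    by (intro rep_isoI[of _ _ "1\<^sub>m (fst V)" "1\<^sub>m (fst V)"]) simp_all
qed

definition iso_rel :: "('a, 'k) mrep rel" where
  "iso_rel = {(V, W). V \<in> irreps G \<and> W \<in> irreps G \<and> rep_iso G V W}"

abbreviation cl :: "('a, 'k) mrep \<Rightarrow> ('a, 'k) mrep set" where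
  "cl V \<equiv> iso_rel `` {V}"

lemma irr_classes_eq: "irr_classes G = irreps G // iso_rel"
  by (simp add: irr_classes_def iso_rel_def)

lemma equiv_iso_rel: "equiv (irreps G) iso_rel"
proof (rule equivI)
  show "refl_on (irreps G) iso_rel"
    by (auto simp: refl_on_def iso_rel_def intro: rep_iso_refl irreducible_repD)
  show "sym iso_rel"
    by (auto simp: sym_def iso_rel_def intro: rep_iso_sym irreducible_repD)
  show "trans iso_rel"
    unfolding trans_def iso_rel_def using rep_iso_trans irreducible_repD by blast
qed (auto simp: iso_rel_def)

lemma cl_eq_iff: "V \<in> irreps G \<Longrightarrow> W \<in> irreps G \<Longrightarrow> cl V = cl W \<longleftrightarrow> rep_iso G V W"
  using eq_equiv_class_iff[OF equiv_iso_rel] by (auto simp: iso_rel_def)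

lemma cl_eqI: "W \<in> cl V \<Longrightarrow> cl W = cl V"
  using equiv_class_eq[OF equiv_iso_rel] by (auto simp: sym_def)

lemma mem_cl: "V \<in> irreps G \<Longrightarrow> V \<in> cl V"
  by (rule equiv_class_self[OF equiv_iso_rel])

lemma cl_irreps: "W \<in> cl V \<Longrightarrow> W \<in> irreps G"
  by (auto simp: iso_rel_def)

lemma cl_in_irr_classes: "V \<in> irreps G \<Longrightarrow> cl V \<in> irr_classes G"
  by (auto simp: irr_classes_eq intro: quotientI)

lemma irr_classesE:
  assumes "c \<in> irr_classes G"
  obtains V where "V \<in> irreps G" "c = cl V"
  using assms unfolding irr_classes_eq by (rule quotientE)

lemma cl_sharp_cong: "V \<in> irreps G \<Longrightarrow> W \<in> irreps G \<Longrightarrow> cl V = cl W \<Longrightarrow> cl (sh V) = cl (sh W)"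
  using rep_iso_sharp[of V W] cl_eq_iff[of V W] cl_eq_iff[of "sh W" "sh V"]
  by (simp add: irreducible_sharp irreducible_repD)

lemma cl_sharp_sharp: "V \<in> irreps G \<Longrightarrow> cl (sh (sh V)) = cl V"
  by (simp add: cl_eq_iff irreducible_sharp rep_iso_sharp_sharp irreducible_repD)

lemma sharp_rel_iff:
  assumes V: "V \<in> irreps G" and W: "W \<in> irreps G"
  shows "(cl V, cl W) \<in> sharp_rel G \<alpha> \<tau> \<longleftrightarrow> cl W = cl (sh V)"
proof
  assume "(cl V, cl W) \<in> sharp_rel G \<alpha> \<tau>"
  then obtain U where U: "U \<in> cl V" "sh U \<in> cl W"
    by (auto simp: sharp_rel_def)
  then show "cl W = cl (sh V)"
    using cl_eqI[OF U(1)] cl_eqI[OF U(2)] cl_sharp_cong[OF cl_irreps[OF U(1)] V] by simp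
next
  assume "cl W = cl (sh V)"
  then show "(cl V, cl W) \<in> sharp_rel G \<alpha> \<tau>"
    using mem_cl[OF V] mem_cl[OF irreducible_sharp[OF V]] cl_in_irr_classes[OF V] cl_in_irr_classes[OF W]
    unfolding sharp_rel_def by blast
qed

text \<open>On isomorphism classes the sharp operation is an involution and \<open>sharp_rel\<close>
  is its graph, so the generated equivalence classes are its orbits.\<close>

lemma sharp_class_eq:
  assumes V: "V \<in> irreps G"
  shows "(sharp_rel G \<alpha> \<tau> \<union> (sharp_rel G \<alpha> \<tau>)\<inverse>)\<^sup>* `` {cl V} = {cl V, cl (sh V)}"
    (is "?E\<^sup>* `` _ = ?C")
proof -
  \<comment> \<open>An edge followed in either direction applies the same involution.\<close>
  have step: "d = cl (sh W)" if "(cl W, d) \<in> ?E" "W \<in> irreps G" for W d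
  proof -
    have "d \<in> irr_classes G"
      using that(1) by (auto simp: sharp_rel_def)
    then obtain U where U: "U \<in> irreps G" "d = cl U"
      by (rule irr_classesE)
    have "cl U = cl (sh W) \<or> cl W = cl (sh U)"
      using that U sharp_rel_iff by auto
    then show ?thesis
      using U that(2) cl_sharp_cong[OF _ irreducible_sharp[OF U(1)], of W] cl_sharp_sharp[OF U(1)] by auto
  qed
  have "d \<in> ?C" if "(cl V, d) \<in> ?E\<^sup>*" for d
    using that
  proof (induction rule: rtrancl_induct)
    case base
    then show ?case by simp
  next
    case (step c d)
    from step.IH have "c = cl V \<or> c = cl (sh V)" by simp
    then show ?case
    proof
      assume "c = cl V"
      then show ?thesis
        using \<open>\<And>W d. (cl W, d) \<in> ?E \<Longrightarrow> W \<in> irreps G \<Longrightarrow> d = cl (sh W)\<close>[of V d] step.hyps(2) V by simp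
    next
      assume "c = cl (sh V)"
      then show ?thesis
        using \<open>\<And>W d. (cl W, d) \<in> ?E \<Longrightarrow> W \<in> irreps G \<Longrightarrow> d = cl (sh W)\<close>[of "sh V" d] step.hyps(2)
          irreducible_sharp[OF V] cl_sharp_sharp[OF V] by simp
    qed
  qed
  moreover have "(cl V, d) \<in> ?E\<^sup>*" if "d \<in> ?C" for d
    using that sharp_rel_iff[OF V irreducible_sharp[OF V]] by (elim insertE) auto
  ultimately show ?thesis
    by (intro subset_antisym subsetI) (simp_all only: Image_singleton_iff)
qed

lemma sharp_classes_iff:
  "C \<in> sharp_classes G \<alpha> \<tau> \<longleftrightarrow> (\<exists>V\<in>irreps G. C = {cl V, cl (sh V)})"
proof
  assume "C \<in> sharp_classes G \<alpha> \<tau>"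
  then obtain c where "c \<in> irr_classes G" "C = (sharp_rel G \<alpha> \<tau> \<union> (sharp_rel G \<alpha> \<tau>)\<inverse>)\<^sup>* `` {c}"
    unfolding sharp_classes_def by (rule quotientE)
  then show "\<exists>V\<in>irreps G. C = {cl V, cl (sh V)}"
    by (metis irr_classesE sharp_class_eq)
next
  assume "\<exists>V\<in>irreps G. C = {cl V, cl (sh V)}"
  then obtain V where "V \<in> irreps G" "C = {cl V, cl (sh V)}"
    by blast
  then show "C \<in> sharp_classes G \<alpha> \<tau>"
    unfolding sharp_classes_def
    using sharp_class_eq[of V] quotientI[OF cl_in_irr_classes[of V]] by metis
qed

text \<open>The choice in \<open>class_rep\<close> may land in either isomorphism class of the
  orbit. The orbit generated by the chosen representation is the same in both cases.\<close>

lemma class_rep_sharp_class: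
  assumes "C \<in> sharp_classes G \<alpha> \<tau>"
  shows "class_rep C \<in> irreps G" "C = {cl (class_rep C), cl (sh (class_rep C))}"
proof -
  let ?V = "class_rep C"
  obtain V where V: "V \<in> irreps G" "C = {cl V, cl (sh V)}"
    using assms sharp_classes_iff by blast
  have "\<exists>W. W \<in> \<Union>C"
    using mem_cl[OF V(1)] V(2) by blast
  then have "?V \<in> \<Union>C"
    unfolding class_rep_def by (rule someI_ex)
  then have mem: "?V \<in> cl V \<or> ?V \<in> cl (sh V)"
    using V(2) by simp
  then show irr: "?V \<in> irreps G"
    using cl_irreps by blast
  from mem show "C = {cl ?V, cl (sh ?V)}"
  proof
    assume "?V \<in> cl V"
    then have "cl ?V = cl V"
      by (rule cl_eqI)
    then show ?thesis
      using cl_sharp_cong[OF irr V(1)] V(2) by simp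
  next
    assume "?V \<in> cl (sh V)"
    then have "cl ?V = cl (sh V)"
      by (rule cl_eqI)
    then show ?thesis
      using cl_sharp_cong[OF irr irreducible_sharp[OF V(1)]] cl_sharp_sharp[OF V(1)] V(2) by auto
  qed
qed

lemma supported_on_iff:
  assumes "T \<subseteq> irreps G"
  shows "x \<in> supported_on G T \<longleftrightarrow> x \<in> group_algebra G \<and>
    (\<forall>W\<in>irreps G. cl W \<notin> cl ` T \<longrightarrow> rep_ext G W x = 0\<^sub>m (fst W) (fst W))"
proof -
  have "(\<forall>V\<in>T. \<not> rep_iso G V W) \<longleftrightarrow> cl W \<notin> cl ` T" if W: "W \<in> irreps G" for W
  proof -
    have "cl W = cl V \<longleftrightarrow> rep_iso G V W" if "V \<in> T" for V
      using cl_eq_iff[of V W] assms that W by (metis subsetD)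
    then show ?thesis
      unfolding image_iff by blast
  qed
  then show ?thesis
    by (auto simp: supported_on_def)
qed

text \<open>Here \<open>V\<close> and \<open>sh V\<close> may be isomorphic, so that one description
  serves even and odd classes alike. Within the given support, the eigenvalue equation only has to
  be compared at \<open>V\<close> and \<open>sh V\<close>.\<close>

lemma gl_part_eq:
  assumes V: "V \<in> irreps G"
  shows "gl_part G \<alpha> \<tau> V = supported_on G {V, sh V} \<inter> skew_part"
proof (intro subset_antisym subsetI)
  note VG = irreducible_repD[OF V]
  fix y assume "y \<in> gl_part G \<alpha> \<tau> V"
  then have supp: "y \<in> supported_on G {V, sh V}"
    and comp: "rep_ext G (sh V) y = - transpose_mat (rep_ext G V y)"
    by (auto simp: gl_part_def)
  have "y + S y = 0"
  proof (rule eq_0_if_irreps_vanish)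
    show "y + S y \<in> group_algebra G"
      using supp ga.subspace_add[OF subspace_group_algebra _ S_group_algebra] by (auto simp: supported_on_def)
    fix W :: "('a, 'k) mrep" assume W: "W \<in> irreps G"
    have rep_ext_W: "rep_ext G W (y + S y) = rep_ext G W y + transpose_mat (rep_ext G (sh W) y)"
      if "is_rep G W" for W
      by (simp add: rep_ext_add rep_ext_S[OF that])
    have at_V: "rep_ext G V (y + S y) = 0\<^sub>m (fst V) (fst V)"
      unfolding rep_ext_W[OF VG] comp by (rule eq_matI) auto
    \<comment> \<open>On the group the double dual has the very matrices of \<open>V\<close>, so the
      condition at \<open>sh V\<close> is the transpose of the one at \<open>V\<close>.\<close>
    have "rep_ext G (sh (sh V)) y = rep_ext G V y"
      by (rule rep_ext_cong) (simp_all add: snd_sharp_sharp[OF VG])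
    then have at_sharp: "rep_ext G (sh V) (y + S y) = 0\<^sub>m (fst V) (fst V)"
      unfolding rep_ext_W[OF is_rep_sharp[OF VG]] comp by (intro eq_matI) auto
    show "rep_ext G W (y + S y) = 0\<^sub>m (fst W) (fst W)"
    proof (cases "cl W = cl V \<or> cl W = cl (sh V)")
      case True
      then show ?thesis
      proof
        assume "cl W = cl V"
        then have "rep_iso G V W"
          using cl_eq_iff[OF V W] by simp
        then show ?thesis
          using rep_ext_eq_0_iso[OF _ VG irreducible_repD[OF W]] at_V by blast
      next
        assume "cl W = cl (sh V)"
        then have "rep_iso G (sh V) W"
          using cl_eq_iff[OF irreducible_sharp[OF V] W] by simp
        then show ?thesis
          using rep_ext_eq_0_iso[OF _ is_rep_sharp[OF VG] irreducible_repD[OF W]] at_sharp by simp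
      qed
    next
      case False
      \<comment> \<open>The orbit is stable under the involution: if \<open>W\<close> lies outside
        it, so does \<open>sh W\<close>, and the components of both \<open>y\<close> and
        \<open>S y\<close> at \<open>W\<close> vanish.\<close>
      have "cl (sh W) \<noteq> cl V" "cl (sh W) \<noteq> cl (sh V)"
        using False cl_sharp_cong[OF irreducible_sharp[OF W] V] cl_sharp_sharp[OF W] cl_sharp_sharp[OF V]
          cl_sharp_cong[OF irreducible_sharp[OF W] irreducible_sharp[OF V]] by auto
      then have "rep_ext G W y = 0\<^sub>m (fst W) (fst W)" "rep_ext G (sh W) y = 0\<^sub>m (fst W) (fst W)"
        using supp False W irreducible_sharp[OF W] V irreducible_sharp[OF V]
        by (simp_all add: supported_on_iff)
      then show ?thesis
        unfolding rep_ext_W[OF irreducible_repD[OF W]] by simp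
    qed
  qed
  then have "S y = - y"
    by (simp only: add_eq_0_iff)
  with supp show "y \<in> supported_on G {V, sh V} \<inter> skew_part"
    by (auto simp: skew_part_def supported_on_def)
next
  note VG = irreducible_repD[OF V]
  fix y assume y: "y \<in> supported_on G {V, sh V} \<inter> skew_part"
  then have "S y = - y"
    by (simp add: skew_part_def)
  then have "transpose_mat (rep_ext G (sh V) y) = - rep_ext G V y"
    using rep_ext_S[OF VG, of y] by (simp add: rep_ext_uminus)
  then have "rep_ext G (sh V) y = transpose_mat (- rep_ext G V y)"
    by (metis Matrix.transpose_transpose)
  also have "\<dots> = - transpose_mat (rep_ext G V y)"
    by (rule eq_matI) auto
  finally show "y \<in> gl_part G \<alpha> \<tau> V"
    using y unfolding gl_part_def by (auto intro!: image_eqI[of _ _ "rep_ext G V y"])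
qed

section \<open>The Lie algebras\<close>

text \<open>An isomorphism \<open>P\<close> from \<open>V\<close> to \<open>sh V\<close> is used as
  the matrix of the form. Intertwining at \<open>\<tau> g\<close> produces the scalar \<alpha>(g)
  and the transposed matrix of \<open>inv g\<close>, which cancels against the transposed matrix of
  \<open>g\<close>; invertibility of \<open>P\<close> gives nondegeneracy.\<close>

lemma sharp_form_exists:
  assumes V: "is_rep G V" and iso: "rep_iso G V (sh V)"
  shows "\<exists>\<phi>. is_sharp_form G \<alpha> \<tau> V \<phi>"
proof -
  let ?n = "fst V"
  note VG = is_repD[OF V]
  obtain P Q where PQ: "P \<in> carrier_mat ?n ?n" "Q \<in> carrier_mat ?n ?n"
    "P * Q = 1\<^sub>m ?n" "Q * P = 1\<^sub>m ?n" "\<And>g. g \<in> carrier G \<Longrightarrow> P * snd V g = snd (sh V) g * P"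
    by (rule rep_isoE[OF iso, unfolded fst_sharp], rule that)
  let ?\<phi> = "\<lambda>x y. x \<bullet> (P *\<^sub>v y)"
  have P_vec: "P *\<^sub>v x \<in> carrier_vec ?n" "Q *\<^sub>v x \<in> carrier_vec ?n" if "x \<in> carrier_vec ?n" for x
    using PQ(1,2) that by auto
  have PQ_vec: "P *\<^sub>v (Q *\<^sub>v x) = x" "Q *\<^sub>v (P *\<^sub>v x) = x" if "x \<in> carrier_vec ?n" for x
    using assoc_mult_mat_vec[OF PQ(1,2) that] assoc_mult_mat_vec[OF PQ(2,1) that] PQ(3,4) that by simp_all
  have "nondegenerate_bilinear_form ?n ?\<phi>"
    unfolding nondegenerate_bilinear_form_def
  proof (intro conjI ballI allI impI)
    fix x y z :: "'k vec" assume xyz: "x \<in> carrier_vec ?n" "y \<in> carrier_vec ?n" "z \<in> carrier_vec ?n"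
    show "?\<phi> (x + y) z = ?\<phi> x z + ?\<phi> y z"
      using xyz P_vec by (intro add_scalar_prod_distrib) auto
    show "?\<phi> z (x + y) = ?\<phi> z x + ?\<phi> z y"
      using xyz P_vec by (simp add: mult_add_distrib_mat_vec[OF PQ(1)] scalar_prod_add_distrib[of _ ?n])
  next
    fix c and x y :: "'k vec" assume xy: "x \<in> carrier_vec ?n" "y \<in> carrier_vec ?n"
    show "?\<phi> (c \<cdot>\<^sub>v x) y = c * ?\<phi> x y"
      using xy P_vec by simp
    show "?\<phi> x (c \<cdot>\<^sub>v y) = c * ?\<phi> x y"
      using xy P_vec by (simp add: mult_mat_vec[OF PQ(1)])
  next
    fix x assume x: "x \<in> carrier_vec ?n" "\<forall>y\<in>carrier_vec ?n. ?\<phi> x y = 0"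
    have "x \<bullet> z = 0" if "z \<in> carrier_vec ?n" for z
      using x(2) PQ_vec(1)[OF that] P_vec(2)[OF that] by metis
    then show "x = 0\<^sub>v ?n"
      by (rule vec_eq_0_if_scalar_prod_0[OF x(1)])
  next
    fix y assume y: "y \<in> carrier_vec ?n" "\<forall>x\<in>carrier_vec ?n. ?\<phi> x y = 0"
    have "P *\<^sub>v y = 0\<^sub>v ?n"
      using y P_vec(1)[OF y(1)] comm_scalar_prod[OF P_vec(1)[OF y(1)]]
      by (intro vec_eq_0_if_scalar_prod_0) auto
    then show "y = 0\<^sub>v ?n"
      using PQ_vec(2)[OF y(1)] mult_mat_zero_vec[OF PQ(2)] by simp
  qed
  moreover have "?\<phi> (snd V g *\<^sub>v x) (snd V (\<tau> g) *\<^sub>v y) = \<alpha> g * ?\<phi> x y"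
    if g: "g \<in> carrier G" and xy: "x \<in> carrier_vec ?n" "y \<in> carrier_vec ?n" for g x y
  proof -
    have A: "snd V g \<in> carrier_mat ?n ?n" "snd V (\<tau> g) \<in> carrier_mat ?n ?n" "snd V (inv g) \<in> carrier_mat ?n ?n"
      "snd (sh V) (\<tau> g) \<in> carrier_mat ?n ?n"
      using VG(1) is_repD(1)[OF is_rep_sharp[OF V]] g by auto
    have gx: "snd V g *\<^sub>v x \<in> carrier_vec ?n"
      using A(1) xy(1) by simp
    let ?z = "P *\<^sub>v y"
    have z: "?z \<in> carrier_vec ?n" "transpose_mat (snd V (inv g)) *\<^sub>v ?z \<in> carrier_vec ?n"
      using P_vec xy A(3) by auto
    have "P *\<^sub>v (snd V (\<tau> g) *\<^sub>v y) = snd (sh V) (\<tau> g) *\<^sub>v ?z"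
      using assoc_mult_mat_vec[OF PQ(1) A(2) xy(2)] assoc_mult_mat_vec[OF A(4) PQ(1) xy(2)] PQ(5)[of "\<tau> g"] g
      by simp
    also have "\<dots> = \<alpha> g \<cdot>\<^sub>v (transpose_mat (snd V (inv g)) *\<^sub>v ?z)"
      using A(3) z(1) g by (simp add: snd_sharp twinv_def smult_mat_mult_vec[of _ ?n ?n])
    finally have "?\<phi> (snd V g *\<^sub>v x) (snd V (\<tau> g) *\<^sub>v y)
        = \<alpha> g * (x \<bullet> (transpose_mat (snd V g) *\<^sub>v (transpose_mat (snd V (inv g)) *\<^sub>v ?z)))"
      using scalar_prod_mult_mat_vec[OF A(1) xy(1) z(2)] scalar_prod_smult_distrib[OF gx z(2)] by simp
    also have "transpose_mat (snd V g) *\<^sub>v (transpose_mat (snd V (inv g)) *\<^sub>v ?z)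
        = transpose_mat (snd V (inv g) * snd V g) *\<^sub>v ?z"
      using assoc_mult_mat_vec[of "transpose_mat (snd V g)" ?n ?n "transpose_mat (snd V (inv g))" ?n ?z]
        transpose_mult[OF A(3,1)] A(1,3) z(1) by simp
    also have "snd V (inv g) * snd V g = 1\<^sub>m ?n"
      using VG(2)[of "inv g" g] VG(3) g by simp
    finally show ?thesis
      using z(1) by simp
  qed
  ultimately show ?thesis
    unfolding is_sharp_form_def by blast
qed

text \<open>As \<open>sharp_form\<close> is an arbitrary choice, only its defining property is
  available. The matrix \<open>B\<close> of whichever form was chosen is an intertwiner from
  \<open>V\<close> to \<open>sh V\<close>, and Schur's lemma makes it invertible.\<close>

lemma sharp_form_intertwiner:
  assumes V: "V \<in> irreps G" and iso: "rep_iso G V (sh V)"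
  obtains B Q where "B \<in> carrier_mat (fst V) (fst V)" "Q \<in> carrier_mat (fst V) (fst V)"
    "B * Q = 1\<^sub>m (fst V)" "\<And>g. g \<in> carrier G \<Longrightarrow> B * snd V g = snd (sh V) g * B"
    "\<And>x y. x \<in> carrier_vec (fst V) \<Longrightarrow> y \<in> carrier_vec (fst V) \<Longrightarrow>
      sharp_form G \<alpha> \<tau> V x y = x \<bullet> (B *\<^sub>v y)"
proof -
  let ?n = "fst V"
  note VG = is_repD[OF irreducible_repD[OF V]]
  have form: "is_sharp_form G \<alpha> \<tau> V (sharp_form G \<alpha> \<tau> V)"
    unfolding sharp_form_def using sharp_form_exists[OF irreducible_repD[OF V] iso] by (rule someI_ex)
  then have nondeg: "nondegenerate_bilinear_form ?n (sharp_form G \<alpha> \<tau> V)"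
    by (simp add: is_sharp_form_def)
  obtain B where B: "B \<in> carrier_mat ?n ?n"
    "\<And>x y. x \<in> carrier_vec ?n \<Longrightarrow> y \<in> carrier_vec ?n \<Longrightarrow> sharp_form G \<alpha> \<tau> V x y = x \<bullet> (B *\<^sub>v y)"
    by (rule bilinear_form_mat[OF nondeg], rule that)
  have comm: "B * snd V h = snd (sh V) h * B" if h: "h \<in> carrier G" for h
  proof -
    let ?A = "snd V (\<tau> h)" and ?A' = "snd V (twinv h)"
    have A: "?A \<in> carrier_mat ?n ?n" "?A' \<in> carrier_mat ?n ?n" "snd V h \<in> carrier_mat ?n ?n"
      using VG(1) h by auto
    have inv: "transpose_mat ?A' * transpose_mat ?A = 1\<^sub>m ?n"
    proof -
      have "?A * ?A' = 1\<^sub>m ?n"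
        using VG(2)[of "\<tau> h" "twinv h", symmetric] VG(3) h by (simp add: twinv_def)
      then show ?thesis
        using transpose_mult[OF A(1,2)] by simp
    qed
    \<comment> \<open>Invariance of the form is applied to the group element
      \<open>\<tau> h\<close>, whose image under \<tau> is \<open>h\<close>. Multiplying by the
      inverse of the left factor then gives the intertwining relation.\<close>
    have "transpose_mat ?A * (B * snd V h) = \<alpha> h \<cdot>\<^sub>m B"
    proof (rule mat_eqI_scalar_prod)
      fix x y :: "'k vec" assume xy: "x \<in> carrier_vec ?n" "y \<in> carrier_vec ?n"
      have Ax: "?A *\<^sub>v x \<in> carrier_vec ?n" and hy: "snd V h *\<^sub>v y \<in> carrier_vec ?n"
        using A xy by auto
      have "x \<bullet> (transpose_mat ?A * (B * snd V h) *\<^sub>v y) = x \<bullet> (transpose_mat ?A *\<^sub>v (B *\<^sub>v (snd V h *\<^sub>v y)))"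
        using A B(1) xy by (simp add: assoc_mult_mat_vec[of _ ?n ?n _ ?n])
      also have "\<dots> = (?A *\<^sub>v x) \<bullet> (B *\<^sub>v (snd V h *\<^sub>v y))"
        using A(1) B(1) xy hy by (intro scalar_prod_mult_mat_vec[symmetric]) auto
      also have "\<dots> = sharp_form G \<alpha> \<tau> V (?A *\<^sub>v x) (snd V h *\<^sub>v y)"
        by (rule B(2)[OF Ax hy, symmetric])
      also have "\<dots> = \<alpha> h * sharp_form G \<alpha> \<tau> V x y"
        using form[unfolded is_sharp_form_def, THEN conjunct2, rule_format, OF tau_closed[OF h] xy] h by simp
      also have "\<dots> = x \<bullet> (\<alpha> h \<cdot>\<^sub>v (B *\<^sub>v y))"
        using B(2)[OF xy] scalar_prod_smult_distrib[OF xy(1), of "B *\<^sub>v y"] B(1) xy(2) by simp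
      also have "\<alpha> h \<cdot>\<^sub>v (B *\<^sub>v y) = (\<alpha> h \<cdot>\<^sub>m B) *\<^sub>v y"
        using B(1) xy by (simp add: smult_mat_mult_vec[of _ ?n ?n])
      finally show "x \<bullet> (transpose_mat ?A * (B * snd V h) *\<^sub>v y) = x \<bullet> ((\<alpha> h \<cdot>\<^sub>m B) *\<^sub>v y)" .
    qed (use A B(1) in auto)
    then have "transpose_mat ?A' * (transpose_mat ?A * (B * snd V h)) = transpose_mat ?A' * (\<alpha> h \<cdot>\<^sub>m B)"
      by simp
    also have "transpose_mat ?A' * (transpose_mat ?A * (B * snd V h))
        = (transpose_mat ?A' * transpose_mat ?A) * (B * snd V h)"
      using A B(1) by (intro assoc_mult_mat[symmetric]) auto
    also have "\<dots> = B * snd V h"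
      unfolding inv using A B(1) by simp
    also have "transpose_mat ?A' * (\<alpha> h \<cdot>\<^sub>m B) = snd (sh V) h * B"
      using A B(1) by (simp add: snd_sharp mult_smult_distrib[of _ ?n ?n _ ?n] mult_smult_assoc_mat[of _ ?n ?n _ ?n])
    finally show ?thesis .
  qed
  \<comment> \<open>A zero matrix would give the zero form, which is degenerate in positive
    degree.\<close>
  have "B \<noteq> 0\<^sub>m ?n ?n"
  proof
    assume "B = 0\<^sub>m ?n ?n"
    then have "sharp_form G \<alpha> \<tau> V x y = 0" if "x \<in> carrier_vec ?n" "y \<in> carrier_vec ?n" for x y
      using B(2)[OF that] that by (simp add: zero_mult_mat_vec)
    then have "unit_vec ?n 0 = (0\<^sub>v ?n :: 'k vec)"
      using nondeg unfolding nondegenerate_bilinear_form_def by (metis unit_vec_carrier)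
    moreover have "0 < ?n"
      using V by (simp add: irreps_def irreducible_rep_def)
    ultimately show False
      by simp
  qed
  then obtain Q where "Q \<in> carrier_mat ?n ?n" "B * Q = 1\<^sub>m ?n"
    using irreducible_intertwiner_invertible[OF V irreducible_sharp[OF V], of B] B(1) comm
    by (metis fst_sharp)
  with B comm show thesis
    by (intro that)
qed

lemma gl_part_iff:
  "y \<in> gl_part G \<alpha> \<tau> V \<longleftrightarrow>
    y \<in> supported_on G {V, sh V} \<and> rep_ext G (sh V) y = - transpose_mat (rep_ext G V y)"
  by (auto simp: gl_part_def intro!: image_eqI[of _ _ "rep_ext G V y"])

text \<open>Let \<open>a\<close>, \<open>b\<close> be the components at \<open>V\<close> and
  \<open>sh V\<close>, and \<open>B\<close> the matrix of the form. Then
  \<open>B * a = b * B\<close>, so the condition defining \<open>osp\<close> reads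
  \<open>(transpose_mat a + b) * B = 0\<close>. Cancelling \<open>B\<close> leaves the condition
  defining \<open>gl_part\<close>.\<close>

lemma osp_part_eq_gl_part:
  assumes V: "V \<in> irreps G" and iso: "rep_iso G V (sh V)"
  shows "osp_part G \<alpha> \<tau> V = gl_part G \<alpha> \<tau> V"
proof -
  let ?n = "fst V"
  note VG = irreducible_repD[OF V]
  have "cl (sh V) = cl V"
    using cl_eq_iff[OF V irreducible_sharp[OF V]] iso by simp
  \<comment> \<open>Both families meet the same single isomorphism class, so they define the same
    block.\<close>
  then have supp: "supported_on G {V} = supported_on G {V, sh V}"
    using V irreducible_sharp[OF V] by (auto simp: supported_on_iff)
  obtain B Q where B: "B \<in> carrier_mat ?n ?n" "Q \<in> carrier_mat ?n ?n"
    "B * Q = 1\<^sub>m ?n" "\<And>g. g \<in> carrier G \<Longrightarrow> B * snd V g = snd (sh V) g * B"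
    "\<And>x y. x \<in> carrier_vec ?n \<Longrightarrow> y \<in> carrier_vec ?n \<Longrightarrow> sharp_form G \<alpha> \<tau> V x y = x \<bullet> (B *\<^sub>v y)"
    by (rule sharp_form_intertwiner[OF V iso], rule that)
  have "rep_ext G V y \<in> osp G \<alpha> \<tau> V \<longleftrightarrow> rep_ext G (sh V) y = - transpose_mat (rep_ext G V y)" for y
  proof -
    define a where "a = rep_ext G V y"
    define b where "b = rep_ext G (sh V) y"
    have a: "a \<in> carrier_mat ?n ?n"
      by (simp add: a_def)
    have b: "b \<in> carrier_mat ?n ?n"
      using rep_ext_carrier[of G "sh V" y] by (simp add: b_def)
    have Ba: "B * a = b * B"
      unfolding a_def b_def using B(1,4) by (intro rep_ext_intertwine VG is_rep_sharp) auto
    let ?M = "transpose_mat a * B + b * B"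
    have M: "?M \<in> carrier_mat ?n ?n"
      using a b B(1) by simp
    have form: "sharp_form G \<alpha> \<tau> V (a *\<^sub>v x) z + sharp_form G \<alpha> \<tau> V x (a *\<^sub>v z) = x \<bullet> (?M *\<^sub>v z)"
      if xz: "x \<in> carrier_vec ?n" "z \<in> carrier_vec ?n" for x z
    proof -
      have az: "a *\<^sub>v x \<in> carrier_vec ?n" "a *\<^sub>v z \<in> carrier_vec ?n" "B *\<^sub>v z \<in> carrier_vec ?n"
        using a B(1) xz by auto
      have "sharp_form G \<alpha> \<tau> V (a *\<^sub>v x) z = x \<bullet> (transpose_mat a * B *\<^sub>v z)"
        using B(5)[OF az(1) xz(2)] scalar_prod_mult_mat_vec[OF a xz(1) az(3)]
          assoc_mult_mat_vec[of "transpose_mat a" ?n ?n B ?n z] a B(1) xz by simp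
      moreover have "sharp_form G \<alpha> \<tau> V x (a *\<^sub>v z) = x \<bullet> (b * B *\<^sub>v z)"
        using B(5)[OF xz(1) az(2)] assoc_mult_mat_vec[OF B(1) a xz(2)] Ba by simp
      moreover have "?M *\<^sub>v z = transpose_mat a * B *\<^sub>v z + b * B *\<^sub>v z"
        using a b B(1) xz by (intro add_mult_distrib_mat_vec) auto
      moreover have "transpose_mat a * B *\<^sub>v z \<in> carrier_vec ?n" "b * B *\<^sub>v z \<in> carrier_vec ?n"
        using a b B(1) xz by (meson mult_carrier_mat mult_mat_vec_carrier transpose_carrier_mat)+
      ultimately show ?thesis
        using scalar_prod_add_distrib[OF xz(1)] by simp
    qed
    have "a \<in> osp G \<alpha> \<tau> V \<longleftrightarrow> (\<forall>x\<in>carrier_vec ?n. \<forall>z\<in>carrier_vec ?n. x \<bullet> (?M *\<^sub>v z) = 0)"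
      using a form by (auto simp: osp_def)
    also have "\<dots> \<longleftrightarrow> ?M = 0\<^sub>m ?n ?n"
      using mat_eqI_scalar_prod[OF M zero_carrier_mat] by (auto simp: zero_mult_mat_vec)
    also have "\<dots> \<longleftrightarrow> transpose_mat a + b = 0\<^sub>m ?n ?n"
    proof -
      have M_eq: "?M = (transpose_mat a + b) * B"
        using a b B(1) by (intro add_mult_distrib_mat[symmetric]) auto
      have ab: "transpose_mat a + b \<in> carrier_mat ?n ?n"
        using a b by simp
      have "(transpose_mat a + b) * B * Q = transpose_mat a + b"
        unfolding assoc_mult_mat[OF ab B(1,2)] B(3) by (rule right_mult_one_mat[OF ab])
      then show ?thesis
        unfolding M_eq using left_mult_zero_mat[OF B(1)] left_mult_zero_mat[OF B(2)] by auto
    qed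
    also have "\<dots> \<longleftrightarrow> b = - transpose_mat a"
    proof
      assume sum: "transpose_mat a + b = 0\<^sub>m ?n ?n"
      show "b = - transpose_mat a"
      proof (rule eq_matI)
        fix i j assume "i < dim_row (- transpose_mat a)" "j < dim_col (- transpose_mat a)"
        then have ij: "i < ?n" "j < ?n"
          using a by auto
        then have "a $$ (j, i) + b $$ (i, j) = (transpose_mat a + b) $$ (i, j)"
          using a b by simp
        also have "\<dots> = 0"
          unfolding sum using ij by simp
        finally show "b $$ (i, j) = (- transpose_mat a) $$ (i, j)"
          using ij a by (simp add: add_eq_0_iff)
      qed (use a b in auto)
    next
      assume "b = - transpose_mat a"
      then show "transpose_mat a + b = 0\<^sub>m ?n ?n"
        using a by (intro eq_matI) auto
    qed
    finally show ?thesis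
      by (simp add: a_def b_def)
  qed
  then show ?thesis
    unfolding gl_part_iff set_eq_iff by (simp add: osp_part_def supp)
qed

text \<open>Orbits of an involution have one or two elements, so even and odd classes exhaust
  \<open>sharp_classes\<close>. In an even class \<open>V\<close> and \<open>sh V\<close> are
  isomorphic, and the two kinds of summand agree.\<close>

lemma lie_M_eq_span_gl_parts:
  "lie_M G \<alpha> \<tau> = ga.span (\<Union>C\<in>sharp_classes G \<alpha> \<tau>. gl_part G \<alpha> \<tau> (class_rep C))"
proof -
  have even: "osp_part G \<alpha> \<tau> (class_rep C) = gl_part G \<alpha> \<tau> (class_rep C)"
    if C: "C \<in> even_classes G \<alpha> \<tau>" for C
  proof -
    have "C \<in> sharp_classes G \<alpha> \<tau>" "card C = 1"
      using C by (auto simp: even_classes_def)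
    define V where "V = class_rep C"
    note V = class_rep_sharp_class[OF \<open>C \<in> sharp_classes G \<alpha> \<tau>\<close>, folded V_def]
    obtain c where "C = {c}"
      using \<open>card C = 1\<close> by (rule card_1_singletonE)
    then have "cl V = cl (sh V)"
      using V(2) by (metis insertI1 insertI2 singletonD)
    then show ?thesis
      unfolding V_def[symmetric]
      using V(1) by (intro osp_part_eq_gl_part) (simp_all add: cl_eq_iff irreducible_sharp)
  qed
  have "card C = 1 \<or> card C = 2" if C: "C \<in> sharp_classes G \<alpha> \<tau>" for C
  proof -
    obtain c d where "C = {c, d}"
      using class_rep_sharp_class(2)[OF C] by (rule that)
    then show ?thesis
      by (cases "c = d") auto
  qed
  then have "sharp_classes G \<alpha> \<tau> = even_classes G \<alpha> \<tau> \<union> odd_classes G \<alpha> \<tau>"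
    by (auto simp: even_classes_def odd_classes_def)
  then show ?thesis
    unfolding lie_M_def using even by simp
qed

lemma lie_M_eq_skew_part: "lie_M G \<alpha> \<tau> = skew_part"
proof (intro subset_antisym subsetI)
  have "(\<Union>C\<in>sharp_classes G \<alpha> \<tau>. gl_part G \<alpha> \<tau> (class_rep C)) \<subseteq> skew_part"
    using gl_part_eq class_rep_sharp_class(1) by blast
  then have "lie_M G \<alpha> \<tau> \<subseteq> skew_part"
    unfolding lie_M_eq_span_gl_parts by (rule ga.span_minimal) (rule subspace_skew_part)
  then show "x \<in> skew_part" if "x \<in> lie_M G \<alpha> \<tau>" for x
    using that by blast
next
  have sub: "ga.subspace (lie_M G \<alpha> \<tau>)"
    by (simp add: lie_M_def)
  \<comment> \<open>The preimage of \<open>lie_M\<close> under \<open>x \<mapsto> x - S x\<close>.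
    Being a subspace, it is the whole group algebra once it contains every block.\<close>
  define N where "N = {x. x - S x \<in> lie_M G \<alpha> \<tau>}"
  have "ga.subspace N"
  proof (rule ga.subspaceI)
    show "0 \<in> N"
      using ga.subspace_0[OF sub] by (simp add: N_def S_zero)
    show "x + y \<in> N" if "x \<in> N" "y \<in> N" for x y
    proof -
      have "(x + y) - S (x + y) = (x - S x) + (y - S y)"
        by (simp add: S_add)
      moreover have "(x - S x) + (y - S y) \<in> lie_M G \<alpha> \<tau>"
        using that by (intro ga.subspace_add[OF sub]) (simp_all add: N_def)
      ultimately show ?thesis
        by (simp only: N_def mem_Collect_eq)
    qed
    show "ga_scale c x \<in> N" if "x \<in> N" for c x
    proof -
      have "ga_scale c x - S (ga_scale c x) = ga_scale c (x - S x)"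
        by (simp add: S_scale ga.scale_right_diff_distrib)
      moreover have "ga_scale c (x - S x) \<in> lie_M G \<alpha> \<tau>"
        using that by (intro ga.subspace_scale[OF sub]) (simp add: N_def)
      ultimately show ?thesis
        by (simp only: N_def mem_Collect_eq)
    qed
  qed
  moreover have "supported_on G {V} \<subseteq> N" if V: "V \<in> irreps G" for V
  proof
    fix x assume x: "x \<in> supported_on G {V}"
    define C where "C = {cl V, cl (sh V)}"
    have C: "C \<in> sharp_classes G \<alpha> \<tau>"
      using V by (auto simp: C_def sharp_classes_iff)
    \<comment> \<open>The summand is built from the chosen representative of the orbit, which may be
      isomorphic to \<open>sh V\<close> instead of \<open>V\<close>; only the orbit is used
      below.\<close>
    define W where "W = class_rep C"
    note W = class_rep_sharp_class[OF C, folded W_def]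
    have sub_irreps: "{W, sh W} \<subseteq> irreps G"
      using W(1) irreducible_sharp[OF W(1)] by simp
    \<comment> \<open>The component of \<open>S x\<close> at \<open>U\<close> is a transposed
      component of \<open>x\<close> at \<open>sh U\<close>, so \<open>x\<close> in the block of
      \<open>V\<close> has \<open>S x\<close> in the block of \<open>sh V\<close>.\<close>
    have "x - S x \<in> supported_on G {W, sh W}"
      unfolding supported_on_iff[OF sub_irreps]
    proof (intro conjI ballI impI)
      show "x - S x \<in> group_algebra G"
        using x by (intro ga.subspace_diff[OF subspace_group_algebra] S_group_algebra) (simp add: supported_on_def)
      fix U :: "('a, 'k) mrep" assume U: "U \<in> irreps G" and neq: "cl U \<notin> cl ` {W, sh W}"
      have "cl U \<notin> C"
        using neq unfolding W(2) by simp
      then have "cl U \<noteq> cl V" "cl U \<noteq> cl (sh V)"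
        by (auto simp: C_def)
      moreover from this have "cl (sh U) \<noteq> cl V"
        using cl_sharp_cong[OF irreducible_sharp[OF U] V] cl_sharp_sharp[OF U] by auto
      ultimately have "rep_ext G U x = 0\<^sub>m (fst U) (fst U)" "rep_ext G (sh U) x = 0\<^sub>m (fst U) (fst U)"
        using x U irreducible_sharp[OF U] V by (simp_all add: supported_on_iff)
      then show "rep_ext G U (x - S x) = 0\<^sub>m (fst U) (fst U)"
        by (simp add: rep_ext_diff rep_ext_S[OF irreducible_repD[OF U]])
    qed
    moreover have "x - S x \<in> skew_part"
      using x by (intro diff_S_skew_part) (simp add: supported_on_def)
    ultimately have "x - S x \<in> gl_part G \<alpha> \<tau> W"
      by (simp add: gl_part_eq[OF W(1)])
    then have "x - S x \<in> lie_M G \<alpha> \<tau>"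
      unfolding lie_M_eq_span_gl_parts using C unfolding W_def by (intro ga.span_base) blast
    then show "x \<in> N"
      by (simp add: N_def)
  qed
  ultimately have "group_algebra G \<subseteq> N"
    unfolding group_algebra_eq_span_supported by (intro ga.span_minimal) blast+
  fix x assume x: "x \<in> skew_part"
  then have "x - S x \<in> lie_M G \<alpha> \<tau>"
    using \<open>group_algebra G \<subseteq> N\<close> by (auto simp: N_def skew_part_def)
  then have "ga_scale (1 / 2) (x - S x) \<in> lie_M G \<alpha> \<tau>"
    by (rule ga.subspace_scale[OF sub])
  then show "x \<in> lie_M G \<alpha> \<tau>"
    using skew_part_eq_half_diff[OF x] by (rule ssubst[rotated])
qed

end

theorem corollary3p14:
  fixes G :: "('g, 'b) monoid_scheme"
    and \<alpha> :: "'g \<Rightarrow> 'k::field_char_0"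
    and \<tau> :: "'g \<Rightarrow> 'g"
  assumes "group G" and "finite (carrier G)"
    and "all_reps_defined_over G TYPE('k)"
    and "\<alpha> \<in> hom G (mult_group TYPE('k))"
    and "\<tau> \<in> iso G G" and "\<forall>g\<in>carrier G. \<tau> (\<tau> g) = g"
    and "\<forall>g\<in>carrier G. \<alpha> (\<tau> g) = \<alpha> g"
  shows "lie_subalgebra G (lie_L G \<alpha> \<tau>) \<and> lie_subalgebra G (lie_M G \<alpha> \<tau>) \<and>
    lie_L G \<alpha> \<tau> = lie_M G \<alpha> \<tau>"
proof -
  interpret group G by fact
  interpret twisted_group G \<alpha> \<tau>
    using assms by unfold_locales auto
  show ?thesis
    by (simp add: lie_L_eq_skew_part lie_M_eq_skew_part lie_subalgebra_skew_part)
qed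

end
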